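(* For $n=1,2$ one has $g^{\mathrm{GEPP}}(\mathrm O(n))=n$. For $n\ge3$, there exists a constant $c\in\left[\frac1{\sqrt3},1\right)$ such that $$g^{\mathrm{GEPP}}(\mathrm O(n))=c\,2^{n-1}(1+o(1)),$$ where $o(1)\to0$ as $n\to\infty$.
   Context: $\mathrm O(n)$ is the group of real orthogonal $n\times n$ matrices. All computations are in exact arithmetic. Gaussian elimination with partial pivoting (GEPP) on $A\in\mathrm{GL}_n(\mathbb R)$ produces $A=A^{(1)},\dots,A^{(n)}$: at step $k$ ($1\le k\le n-1$) a row swap brings an entry of maximal absolute value among $A^{(k)}_{ik}$, $i\ge k$, to position $(k,k)$ (no swap if the entry in position $(k,k)$ is already of maximal absolute value), and then for each $i>k$ the multiple $A^{(k)}_{ik}/A^{(k)}_{kk}$ of row $k$ is subtracted from row $i$, giving $A^{(k+1)}$. The GEPP growth factor is $\rho^{\mathrm{GEPP}}(A)=\dfrac{\max_{i,j,k}|A^{(k)}_{ij}|}{\max_{i,j}|A_{ij}|}$. For $\mathcal S\subset\mathrm{GL}_n(\mathbb R)$, $g^{\mathrm{GEPP}}(\mathcal S)=\max_{A\in\mathcal S}\rho^{\mathrm{GEPP}}(A)$. *)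

theory Defs
  imports Complex_Main "Jordan_Normal_Form.Gauss_Jordan_Elimination"
begin

text \<open>
  Rows, columns and elimination steps are numbered from 0, and \<open>n\<close> is the dimension
  of the matrix: step \<open>k\<close> of the elimination, for \<open>k < n - 1\<close>, turns the \<open>k\<close>-th intermediate
  matrix into the \<open>(k + 1)\<close>-st one.
\<close>

definition orthogonal_group :: "nat \<Rightarrow> real mat set" where
  "orthogonal_group n = {A \<in> carrier_mat n n. transpose_mat A * A = 1\<^sub>m n}"

text \<open>
  Partial pivoting does not determine which row is chosen if several entries below the diagonal
  are maximal, so this choice is kept as a parameter: \<open>p k A\<close> is the row that step \<open>k\<close> swaps with
  row \<open>k\<close> of the current matrix \<open>A\<close>.  The last condition says that no swap takes place if the entry
  in position \<open>(k, k)\<close> is already of maximal absolute value.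
\<close>

definition pivot_rule :: "(nat \<Rightarrow> real mat \<Rightarrow> nat) \<Rightarrow> bool" where
  "pivot_rule p \<longleftrightarrow> (\<forall>n k. \<forall>A \<in> carrier_mat n n. k < n \<longrightarrow>
     p k A \<in> {k..<n} \<and>
     (\<forall>i \<in> {k..<n}. \<bar>A $$ (i, k)\<bar> \<le> \<bar>A $$ (p k A, k)\<bar>) \<and>
     ((\<forall>i \<in> {k..<n}. \<bar>A $$ (i, k)\<bar> \<le> \<bar>A $$ (k, k)\<bar>) \<longrightarrow> p k A = k))"

definition eliminate_below :: "nat \<Rightarrow> real mat \<Rightarrow> real mat" where
  "eliminate_below k A = mat (dim_row A) (dim_col A)
     (\<lambda>(i, j). if k < i then A $$ (i, j) - A $$ (i, k) / A $$ (k, k) * A $$ (k, j)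
               else A $$ (i, j))"

fun gepp :: "(nat \<Rightarrow> real mat \<Rightarrow> nat) \<Rightarrow> real mat \<Rightarrow> nat \<Rightarrow> real mat" where
  "gepp p A 0 = A"
| "gepp p A (Suc k) =
     (let B = gepp p A k in eliminate_below k (swaprows k (p k B) B))"

definition max_abs_entry :: "real mat \<Rightarrow> real" where
  "max_abs_entry A = Max (abs ` elements_mat A)"

definition gepp_growth :: "(nat \<Rightarrow> real mat \<Rightarrow> nat) \<Rightarrow> real mat \<Rightarrow> real" where
  "gepp_growth p A =
     Max ((\<lambda>k. max_abs_entry (gepp p A k)) ` {..<dim_row A}) / max_abs_entry A"

definition max_gepp_growth :: "(nat \<Rightarrow> real mat \<Rightarrow> nat) \<Rightarrow> real mat set \<Rightarrow> real" where
  "max_gepp_growth p S = (SUP A \<in> S. gepp_growth p A)"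

lemma pivot_rule_exists: "\<exists>p. pivot_rule p"
proof -
  define Q where "Q k A r \<longleftrightarrow> (\<forall>n. A \<in> carrier_mat n n \<longrightarrow> k < n \<longrightarrow> r \<in> {k..<n} \<and>
     (\<forall>i \<in> {k..<n}. \<bar>A $$ (i, k)\<bar> \<le> \<bar>A $$ (r, k)\<bar>) \<and>
     ((\<forall>i \<in> {k..<n}. \<bar>A $$ (i, k)\<bar> \<le> \<bar>A $$ (k, k)\<bar>) \<longrightarrow> r = k))"
    for k r and A :: "real mat"
  have "\<exists>r. Q k A r" for k A
  proof (cases "k < dim_row A \<and> \<not> (\<forall>i \<in> {k..<dim_row A}. \<bar>A $$ (i, k)\<bar> \<le> \<bar>A $$ (k, k)\<bar>)")
    case True
    let ?f = "\<lambda>i. \<bar>A $$ (i, k)\<bar>"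
    have "Max (?f ` {k..<dim_row A}) \<in> ?f ` {k..<dim_row A}"
      using True by (intro Max_in) auto
    then obtain r where r: "r \<in> {k..<dim_row A}" "?f r = Max (?f ` {k..<dim_row A})"
      by (metis (no_types, lifting) imageE)
    have "\<forall>i \<in> {k..<dim_row A}. ?f i \<le> ?f r"
      unfolding r(2) by simp
    then show ?thesis
      using True r(1) by (intro exI[of _ r]) (auto simp: Q_def)
  next
    case False
    then show ?thesis by (intro exI[of _ k]) (auto simp: Q_def)
  qed
  then have "Q k A (SOME r. Q k A r)" for k A
    by (rule someI_ex)
  then show ?thesis
    unfolding pivot_rule_def
    by (intro exI[of _ "\<lambda>k A. SOME r. Q k A r"]) (simp add: Q_def)
qed

end

theory Submission
  imports Defs "HOL-Analysis.Function_Topology" "HOL-Real_Asymp.Real_Asymp"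
begin

text \<open>
  The constant is \<open>c = 2/3\<close>; more precisely, the maximal growth lies between \<open>(2/3 - o(1)) 2\<^bsup>n - 1\<^esup>\<close> and
  \<open>2/3 (2\<^bsup>n - 1\<^esup> + 1)\<close>.

  Carrying out all row swaps in advance turns an orthogonal matrix
  into a product \<open>Q = L U\<close> with \<open>L\<close> unit lower triangular and \<open>\<bar>L\<^sub>i\<^sub>j\<bar> \<le> 1\<close>, on which elimination makes no
  swap, whatever the pivot rule; the intermediate matrices only have their rows permuted
  (\<open>gepp_growth_factors\<close>, \<open>factors_gepp_growth\<close>). So the set of growth factors is the same for all pivot
  rules. It is the image of a compact set of pairs \<open>(L, U)\<close> under a continuous function, hence the
  maximum exists (\<open>gepp_growth_attains_max\<close>).

  For the upper bound, entries at most double in each step, so only the last pivot \<open>u = U\<^sub>n\<^sub>n\<close> can exceed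
  \<open>2\<^bsup>n - 2\<^esup>\<close> times the largest entry of \<open>Q\<close>. If \<open>q\<close> is the last column of \<open>Q\<close>, then \<open>v = u q\<close> is the last row
  of \<open>L\<inverse>\<close> (\<open>last_column_left_inverse\<close>). Therefore \<open>\<bar>u\<bar> = \<parallel>v\<parallel>\<close> and the growth due to \<open>u\<close> is at most
  \<open>\<parallel>v\<parallel>\<^sup>2 / max \<bar>v\<^sub>i\<bar>\<close>. From \<open>v L = e\<^sub>n\<close> and \<open>\<bar>L\<^sub>i\<^sub>j\<bar> \<le> 1\<close> one gets \<open>v\<^sub>n = 1\<close> and \<open>\<bar>v\<^sub>j\<bar> \<le> \<Sum>i>j. \<bar>v\<^sub>i\<bar>\<close>, and under
  these constraints the quotient is essentially largest for \<open>2\<^bsup>n - 2\<^esup>, \<dots>, 4, 2, 1, 1\<close>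
  (\<open>dominated_sum_squares_upper\<close>).

  For the lower bound, by Gram-Schmidt any \<open>L\<close> of the above shape occurs (\<open>orthogonal_factor_exists\<close>). What is
  wanted is that the last row of \<open>L\<inverse>\<close> is close to the extremal one, which makes \<open>u\<close> about \<open>2\<^bsup>n - 1\<^esup>/\<surd>3\<close> and
  the last column of \<open>Q\<close> about \<open>\<surd>3/2 (1, 1/2, 1/4, \<dots>)\<close>, and that no other entry of \<open>Q\<close> exceeds \<open>\<surd>3/2\<close>.
  The obvious \<open>L\<close>, with all entries \<open>-1\<close> below the diagonal, fails the second requirement. A block
  construction with a flat orthogonal matrix, explained at the locale \<open>two_block\<close>, satisfies both
  (\<open>near_extremal_growth\<close>).
\<close>

section \<open>Orthogonal matrices as products of triangular factors\<close>

text \<open>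
  If \<open>A = L U\<close> with \<open>L\<close> unit lower and \<open>U\<close> upper triangular, eliminating without row swaps subtracts
  from \<open>A\<close> the rank one terms \<open>L\<^sub>i\<^sub>l U\<^sub>l\<^sub>j\<close> one by one; row \<open>i\<close> is finished after \<open>i\<close> steps. This sum is
  what is left after \<open>k\<close> steps; for \<open>k = 0\<close> it is \<open>A\<close> itself.
  Matrices are functions of two indices, and only the part of \<open>L\<close> on and below the diagonal enters.
\<close>

definition stage :: "(nat \<Rightarrow> nat \<Rightarrow> real) \<Rightarrow> (nat \<Rightarrow> nat \<Rightarrow> real) \<Rightarrow> nat \<Rightarrow> nat \<Rightarrow> nat \<Rightarrow> real" where
  "stage L U k i j = (\<Sum>l\<in>{min i k..i}. L i l * U l j)"

text \<open>
  The factorizations \<open>Q = L U\<close> of orthogonal matrices on which partial pivoting makes no swap: the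
  multipliers have modulus at most 1 exactly if each pivot is maximal in its column.
\<close>

definition pivoted_factors :: "nat \<Rightarrow> (nat \<Rightarrow> nat \<Rightarrow> real) \<Rightarrow> (nat \<Rightarrow> nat \<Rightarrow> real) \<Rightarrow> bool" where
  "pivoted_factors n L U \<longleftrightarrow>
     (\<forall>i<n. L i i = 1) \<and> (\<forall>i<n. \<forall>j<i. \<bar>L i j\<bar> \<le> 1) \<and> (\<forall>i<n. \<forall>j<i. U i j = 0) \<and>
     (\<forall>j<n. \<forall>j'<n. (\<Sum>i<n. stage L U 0 i j * stage L U 0 i j') = (if j = j' then 1 else 0))"

definition entry_max :: "nat \<Rightarrow> (nat \<Rightarrow> nat \<Rightarrow> real) \<Rightarrow> real" where
  "entry_max n X = Max ((\<lambda>(i, j). \<bar>X i j\<bar>) ` ({..<n} \<times> {..<n}))"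

definition lu_growth :: "nat \<Rightarrow> (nat \<Rightarrow> nat \<Rightarrow> real) \<Rightarrow> (nat \<Rightarrow> nat \<Rightarrow> real) \<Rightarrow> real" where
  "lu_growth n L U =
     Max ((\<lambda>k. entry_max n (stage L U k)) ` {..<n}) / entry_max n (stage L U 0)"

lemma pivoted_factorsD:
  assumes "pivoted_factors n L U"
  shows "\<And>i. i < n \<Longrightarrow> L i i = 1" "\<And>i j. i < n \<Longrightarrow> j < i \<Longrightarrow> \<bar>L i j\<bar> \<le> 1"
    "\<And>i j. i < n \<Longrightarrow> j < i \<Longrightarrow> U i j = 0"
    "\<And>j j'. j < n \<Longrightarrow> j' < n \<Longrightarrow>
       (\<Sum>i<n. stage L U 0 i j * stage L U 0 i j') = (if j = j' then 1 else 0)"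
  using assms unfolding pivoted_factors_def by blast+

lemma entry_max_ge:
  assumes "i < n" "j < n"
  shows "\<bar>X i j\<bar> \<le> entry_max n X"
  unfolding entry_max_def using assms by (intro Max_ge) force+

lemma entry_max_le:
  assumes "0 < n" "\<And>i j. i < n \<Longrightarrow> j < n \<Longrightarrow> \<bar>X i j\<bar> \<le> c"
  shows "entry_max n X \<le> c"
proof -
  have "{..<n} \<noteq> {}" using assms(1) by auto
  then show ?thesis unfolding entry_max_def using assms(2) by (subst Max_le_iff) auto
qed

lemma stage_Suc:
  assumes "L k k = 1"
  shows "stage L U (Suc k) i j
    = (if k < i then stage L U k i j - L i k * stage L U k k j else stage L U k i j)"
proof (cases "k < i")
  case True
  then have "{k..i} = insert k {Suc k..i}" by auto
  moreover have "min i k = k" "min i (Suc k) = Suc k" using True by auto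
  ultimately show ?thesis using True assms by (simp add: stage_def)
next
  case False
  then show ?thesis by (simp add: stage_def min_def)
qed

lemma stage_diag: "L i i = 1 \<Longrightarrow> i \<le> k \<Longrightarrow> stage L U k i j = U i j"
  by (simp add: stage_def min_def)

lemma stage_column:
  assumes "\<And>l. k < l \<Longrightarrow> l \<le> i \<Longrightarrow> U l k = 0" "k \<le> i"
  shows "stage L U k i k = L i k * U k k"
proof -
  have "{k..i} = insert k {Suc k..i}" using assms(2) by auto
  then show ?thesis using assms by (simp add: stage_def min_def)
qed

text \<open>
  A step subtracts from an entry a multiple by a factor of modulus at most 1 of another entry of the
  same matrix, so entries at most double.
\<close>

lemma stage_bound:
  assumes pf: "pivoted_factors n L U"
    and M: "\<And>i j. i < n \<Longrightarrow> j < n \<Longrightarrow> \<bar>stage L U 0 i j\<bar> \<le> M"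
  shows "k < n \<Longrightarrow> i < n \<Longrightarrow> j < n \<Longrightarrow> \<bar>stage L U k i j\<bar> \<le> 2 ^ k * M"
proof (induction k arbitrary: i j)
  case 0
  then show ?case using M by simp
next
  case (Suc k)
  have M0: "0 \<le> M" using M[of 0 0] Suc.prems by force
  have st: "\<bar>stage L U k i j\<bar> \<le> 2 ^ k * M" "\<bar>stage L U k k j\<bar> \<le> 2 ^ k * M"
    using Suc by auto
  show ?case
  proof (cases "k < i")
    case True
    have "\<bar>L i k * stage L U k k j\<bar> \<le> 1 * (2 ^ k * M)"
      unfolding abs_mult using st pivoted_factorsD(2)[OF pf _ True] Suc.prems
      by (intro mult_mono) auto
    then show ?thesis
      using True st Suc.prems by (simp add: stage_Suc pivoted_factorsD(1)[OF pf])
  next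
    case False
    then show ?thesis
      using st Suc.prems M0 by (simp add: stage_Suc pivoted_factorsD(1)[OF pf])
  qed
qed

lemma sum_triangle_swap:
  fixes f :: "nat \<Rightarrow> nat \<Rightarrow> real"
  shows "(\<Sum>i<n. \<Sum>l\<in>{0..i}. f i l) = (\<Sum>l<n. \<Sum>i\<in>{l..<n}. f i l)"
proof -
  have "(\<Sum>i<n. \<Sum>l\<in>{0..i}. f i l) = (\<Sum>i<n. \<Sum>l\<in>{l\<in>{..<n}. l \<le> i}. f i l)"
    by (intro sum.cong) auto
  also have "\<dots> = (\<Sum>l<n. \<Sum>i\<in>{i\<in>{..<n}. l \<le> i}. f i l)"
    by (rule sum.swap_restrict) auto
  also have "\<dots> = (\<Sum>l<n. \<Sum>i\<in>{l..<n}. f i l)"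
    by (intro sum.cong) auto
  finally show ?thesis .
qed

lemma sum_mult_stage_0:
  "(\<Sum>i<n. x i * stage L U 0 i m) = (\<Sum>l<n. U l m * (\<Sum>i\<in>{l..<n}. x i * L i l))"
proof -
  have "(\<Sum>i<n. x i * stage L U 0 i m) = (\<Sum>i<n. \<Sum>l\<in>{0..i}. U l m * (x i * L i l))"
    by (simp add: stage_def sum_distrib_left mult_ac)
  then show ?thesis by (simp add: sum_triangle_swap sum_distrib_left)
qed

text \<open>
  Let \<open>q\<^sub>j\<close> be the columns of \<open>Q = L U\<close> and \<open>t\<^sub>j\<^sub>l\<close> the inner product of \<open>q\<^sub>j\<close> with column \<open>l\<close> of \<open>L\<close>.
  Column \<open>m\<close> of \<open>Q\<close> is the combination of the columns \<open>l \<le> m\<close> of \<open>L\<close> with coefficients \<open>U\<^sub>l\<^sub>m\<close>, so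
  orthonormality reads \<open>\<Sum>l\<le>m. U\<^sub>l\<^sub>m t\<^sub>j\<^sub>l = \<delta>\<^sub>j\<^sub>m\<close>. Solving this triangular system from the top shows
  both that the pivots \<open>U\<^sub>m\<^sub>m\<close> do not vanish and that \<open>q\<^sub>j\<close> is orthogonal to the earlier columns of \<open>L\<close>.
\<close>

lemma pivot_and_perp:
  assumes pf: "pivoted_factors n L U"
  shows "m < n \<Longrightarrow> U m m * (\<Sum>i\<in>{m..<n}. stage L U 0 i m * L i m) = 1 \<and>
    (\<forall>j<n. m < j \<longrightarrow> (\<Sum>i\<in>{m..<n}. stage L U 0 i j * L i m) = 0)"
proof (induction m rule: less_induct)
  case (less m)
  define t where "t j l = (\<Sum>i\<in>{l..<n}. stage L U 0 i j * L i l)" for j l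
  have key: "U m m * t j m = (if j = m then 1 else 0)" if j: "m \<le> j" "j < n" for j
  proof -
    have "(if j = m then 1 else 0) = (\<Sum>l<n. U l m * t j l)"
      using pivoted_factorsD(4)[OF pf j(2) less.prems] by (simp add: sum_mult_stage_0 t_def)
    also have "\<dots> = (\<Sum>l<n. if l = m then U m m * t j m else 0)"
    proof (rule sum.cong[OF refl])
      fix l assume l: "l \<in> {..<n}"
      consider "l < m" | "l = m" | "m < l" by linarith
      then show "U l m * t j l = (if l = m then U m m * t j m else 0)"
      proof cases
        case 1
        then show ?thesis using less.IH[OF 1] l j by (auto simp: t_def)
      next
        case 3
        then show ?thesis using pivoted_factorsD(3)[OF pf _ 3] l by auto
      qed auto
    qed
    finally show ?thesis using less.prems by simp
  qed
  have um: "U m m * t m m = 1" using key[of m] less.prems by simp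
  have "t j m = 0" if "j < n" "m < j" for j
    using key[of j] um that by auto
  then show ?case using um unfolding t_def by blast
qed

lemma pivot_nonzero: "pivoted_factors n L U \<Longrightarrow> m < n \<Longrightarrow> U m m \<noteq> 0"
  using pivot_and_perp[of n L U m] by auto

lemma column_perp:
  "pivoted_factors n L U \<Longrightarrow> m < j \<Longrightarrow> j < n \<Longrightarrow>
     (\<Sum>i\<in>{m..<n}. stage L U 0 i j * L i m) = 0"
  using pivot_and_perp[of n L U m] by auto

text \<open>
  The key identity. The last column \<open>q\<close> of \<open>Q\<close> is orthogonal to all columns of \<open>L\<close> but the last one, so
  \<open>v = U\<^sub>n\<^sub>n q\<close> satisfies \<open>v L = e\<^sub>n\<close>: it is the last row of \<open>L\<inverse>\<close>. Hence the last pivot is, up to sign, the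
  Euclidean norm of that row.
\<close>

lemma last_column_left_inverse:
  assumes pf: "pivoted_factors (Suc n) L U"
  defines "v \<equiv> (\<lambda>i. U n n * stage L U 0 i n)"
  shows "v n = 1" "\<And>m. m < n \<Longrightarrow> v m = - (\<Sum>i\<in>{m<..n}. v i * L i m)"
    "(\<Sum>i\<le>n. (v i)\<^sup>2) = (U n n)\<^sup>2"
proof -
  show "v n = 1"
    using pivot_and_perp[OF pf, of n] pivoted_factorsD(1)[OF pf, of n] by (simp add: v_def)
  show "v m = - (\<Sum>i\<in>{m<..n}. v i * L i m)" if m: "m < n" for m
  proof -
    have "{m..<Suc n} = insert m {m<..n}" using m by auto
    then have "(\<Sum>i\<in>{m..<Suc n}. v i * L i m) = v m + (\<Sum>i\<in>{m<..n}. v i * L i m)"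
      using pivoted_factorsD(1)[OF pf, of m] m by simp
    moreover have "(\<Sum>i\<in>{m..<Suc n}. v i * L i m) = 0"
      using column_perp[OF pf m] by (simp add: v_def mult.assoc flip: sum_distrib_left)
    ultimately show ?thesis by simp
  qed
  have "(\<Sum>i<Suc n. stage L U 0 i n * stage L U 0 i n) = 1"
    using pivoted_factorsD(4)[OF pf, of n n] by simp
  then have "(U n n)\<^sup>2 * (\<Sum>i\<le>n. (stage L U 0 i n)\<^sup>2) = (U n n)\<^sup>2"
    by (simp add: power2_eq_square lessThan_Suc_atMost)
  then show "(\<Sum>i\<le>n. (v i)\<^sup>2) = (U n n)\<^sup>2"
    by (simp add: v_def power_mult_distrib sum_distrib_left)
qed

lemma left_inverse_unique:
  fixes v x :: "nat \<Rightarrow> real"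
  assumes "v n = x n" "\<And>m. m < n \<Longrightarrow> v m = - (\<Sum>i\<in>{m<..n}. v i * L i m)"
    "\<And>m. m < n \<Longrightarrow> x m = - (\<Sum>i\<in>{m<..n}. x i * L i m)"
  shows "m \<le> n \<Longrightarrow> v m = x m"
proof (induction "n - m" arbitrary: m rule: less_induct)
  case less
  show ?case
  proof (cases "m = n")
    case False
    have "(\<Sum>i\<in>{m<..n}. v i * L i m) = (\<Sum>i\<in>{m<..n}. x i * L i m)"
      using less by (intro sum.cong) auto
    then show ?thesis using assms(2,3)[of m] less.prems False by simp
  qed (use assms in auto)
qed

section \<open>The upper bound\<close>

text \<open>
  Read from the end, the moduli of the last row of \<open>L\<inverse>\<close> form a sequence that starts with 1 and in which
  no later term exceeds the sum of its predecessors. The next lemmas are about such dominated sequences.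
\<close>

lemma dominated_sum_le:
  fixes a :: "nat \<Rightarrow> real"
  assumes "a 0 = 1" "\<And>k. 0 < k \<Longrightarrow> k < n \<Longrightarrow> a k \<le> (\<Sum>i<k. a i)"
  shows "k < n \<Longrightarrow> (\<Sum>i<Suc k. a i) \<le> 2 ^ k"
proof (induction k)
  case (Suc k)
  then show ?case using assms(2)[of "Suc k"] by simp
qed (use assms in simp)

text \<open>
  Appending \<open>x \<le> S\<close> to a sequence with sum \<open>S\<close> increases the square of the sum by \<open>x\<^sup>2 + 2 x S \<ge> 3 x\<^sup>2\<close>.
\<close>

lemma dominated_sum_squares_le:
  fixes a :: "nat \<Rightarrow> real"
  assumes "a 0 = 1" "\<And>k. k < n \<Longrightarrow> 0 \<le> a k"
    "\<And>k. 0 < k \<Longrightarrow> k < n \<Longrightarrow> a k \<le> (\<Sum>i<k. a i)"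
  shows "k < n \<Longrightarrow> 3 * (\<Sum>i<Suc k. (a i)\<^sup>2) \<le> (\<Sum>i<Suc k. a i)\<^sup>2 + 2"
proof (induction k)
  case (Suc k)
  define S where "S = (\<Sum>i<Suc k. a i)"
  have "0 \<le> a (Suc k)" "a (Suc k) \<le> S" using assms(2)[of "Suc k"] assms(3)[of "Suc k"] Suc.prems unfolding S_def by auto
  then have "a (Suc k) * a (Suc k) \<le> a (Suc k) * S" by (intro mult_left_mono) auto
  moreover have "3 * (\<Sum>i<Suc k. (a i)\<^sup>2) \<le> S\<^sup>2 + 2" using Suc unfolding S_def by simp
  moreover have "(\<Sum>i<Suc (Suc k). a i) = S + a (Suc k)" by (simp add: S_def)
  ultimately show ?case
    by (simp add: power2_sum) (simp add: power2_eq_square algebra_simps)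
qed (use assms in simp)

text \<open>
  A sharper bound once the sum \<open>S\<close> has reached an upper bound \<open>M\<close> of the terms. From then on a term
  \<open>x \<le> M\<close> contributes at most \<open>M x\<close> to the sum of squares. At the moment where \<open>S\<close> passes \<open>M\<close> it is
  still below \<open>2 M\<close>, and there the bound follows from the previous lemma, because \<open>(S - M) (2 M - S) \<ge> 0\<close>.
\<close>

lemma dominated_sum_squares_le_max:
  fixes a :: "nat \<Rightarrow> real"
  assumes a: "a 0 = 1" "\<And>k. k < n \<Longrightarrow> 0 \<le> a k"
    "\<And>k. 0 < k \<Longrightarrow> k < n \<Longrightarrow> a k \<le> (\<Sum>i<k. a i)"
    and M: "\<And>k. k < n \<Longrightarrow> a k \<le> M"
  shows "k < n \<Longrightarrow> M \<le> (\<Sum>i<Suc k. a i) \<Longrightarrow>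
    3 * (\<Sum>i<Suc k. (a i)\<^sup>2) \<le> 3 * M * (\<Sum>i<Suc k. a i) - 2 * M\<^sup>2 + 2"
proof (induction k)
  case 0
  then have "M = 1" using a M[of 0] by simp
  then show ?case using a by simp
next
  case (Suc k)
  define S where "S = (\<Sum>i<Suc k. a i)"
  define x where "x = a (Suc k)"
  have x: "0 \<le> x" "x \<le> M" "x \<le> S" 
    using a(2)[of "Suc k"] a(3)[of "Suc k"] M[of "Suc k"] Suc.prems unfolding S_def x_def by auto
  have S': "(\<Sum>i<Suc (Suc k). a i) = S + x" by (simp add: S_def x_def)
  show ?case
  proof (cases "M \<le> S")
    case True
    have "x * x \<le> M * x" using x by (intro mult_right_mono) auto
    moreover have "3 * (\<Sum>i<Suc k. (a i)\<^sup>2) \<le> 3 * M * S - 2 * M\<^sup>2 + 2"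
      using Suc True unfolding S_def by simp
    ultimately show ?thesis unfolding S'
      by (simp add: x_def) (simp add: power2_eq_square algebra_simps)
  next
    case False
    have "3 * (\<Sum>i<Suc (Suc k). (a i)\<^sup>2) \<le> (S + x)\<^sup>2 + 2"
      using dominated_sum_squares_le[OF a Suc.prems(1)] unfolding S' .
    moreover have "(S + x - M) * (2 * M - (S + x)) \<ge> 0"
      using False x Suc.prems(2) unfolding S' by (intro mult_nonneg_nonneg) auto
    ultimately show ?thesis unfolding S'
      by (simp add: power2_eq_square algebra_simps)
  qed
qed

text \<open>
  For \<open>1, 1, 2, 4, \<dots>, 2\<^bsup>n - 1\<^esup>\<close> this is almost an equality. In general the previous bound is, up to
  lower order terms, \<open>M (S - 2/3 M)\<close>, where \<open>S \<le> 2\<^bsup>n - 1\<^esup> + M\<close> and \<open>M \<le> 2\<^bsup>n - 1\<^esup>\<close>.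
\<close>

lemma dominated_sum_squares_upper:
  fixes a :: "nat \<Rightarrow> real"
  assumes a: "a 0 = 1" "\<And>k. k \<le> n \<Longrightarrow> 0 \<le> a k"
    "\<And>k. 0 < k \<Longrightarrow> k \<le> n \<Longrightarrow> a k \<le> (\<Sum>i<k. a i)"
    and M: "\<And>k. k \<le> n \<Longrightarrow> a k \<le> M" and att: "m \<le> n" "M = a m" and n: "0 < n"
  shows "(\<Sum>i\<le>n. (a i)\<^sup>2) \<le> M * (2 / 3 * (2 ^ n + 1))"
proof -
  obtain n' where n': "n = Suc n'" using n by (cases n) auto
  define S where "S = (\<Sum>i<Suc n. a i)"
  have "M \<le> S" unfolding S_def att(2)
    using a(2) att by (intro member_le_sum) auto
  then have 1: "3 * (\<Sum>i<Suc n. (a i)\<^sup>2) \<le> 3 * M * S - 2 * M\<^sup>2 + 2"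
    unfolding S_def using a M by (intro dominated_sum_squares_le_max[of a "Suc n"]) auto
  have "(\<Sum>i<Suc n'. a i) \<le> 2 ^ n'"
    using a n' by (intro dominated_sum_le[of a "Suc n"]) auto
  then have S: "S \<le> 2 ^ n' + M" using M[of n] unfolding S_def n' by simp
  have M1: "1 \<le> M" using M[of 0] a by simp
  have aM: "a k \<le> 2 ^ n'" if "k \<le> n" for k
  proof (cases "k = 0")
    case False
    then obtain k' where k': "k = Suc k'" by (cases k) auto
    have "a k \<le> (\<Sum>i<Suc k'. a i)" using a(3)[of k] that k' by simp
    also have "\<dots> \<le> 2 ^ k'" using a that k' by (intro dominated_sum_le[of a "Suc n"]) auto
    also have "\<dots> \<le> 2 ^ n'" using that k' n' by (intro power_increasing) auto
    finally show ?thesis .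
  qed (use a in simp)
  have "M * S \<le> M * (2 ^ n' + M)" using S M1 by (intro mult_left_mono) auto
  then have "M * S \<le> M * 2 ^ n' + M * M" by (simp add: distrib_left)
  moreover have "M * M \<le> M * 2 ^ n'" using aM[OF att(1)] att(2) M1 by (intro mult_left_mono) auto
  moreover have "3 * (\<Sum>i<Suc n. (a i)\<^sup>2) \<le> 3 * (M * S) - 2 * (M * M) + 2"
    using 1 by (simp add: power2_eq_square[of M] mult.assoc del: sum.lessThan_Suc)
  ultimately have "3 * (\<Sum>i<Suc n. (a i)\<^sup>2) \<le> 4 * (M * 2 ^ n') + 2 * M"
    using M1 by linarith
  then show ?thesis by (simp add: n' lessThan_Suc_atMost algebra_simps)
qed

lemma entry_max_pos:
  assumes "pivoted_factors n L U" "0 < n"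
  shows "0 < entry_max n (stage L U 0)"
proof -
  have "stage L U 0 0 0 \<noteq> 0"
    using pivot_nonzero[OF assms] pivoted_factorsD(1)[OF assms] by (simp add: stage_def)
  then show ?thesis using entry_max_ge[of 0 n 0 "stage L U 0"] assms(2) by simp
qed

lemma lu_growth_le_bound:
  assumes pf: "pivoted_factors n L U" and n: "0 < n"
    and c: "\<And>k i j. k < n \<Longrightarrow> i < n \<Longrightarrow> j < n \<Longrightarrow>
      \<bar>stage L U k i j\<bar> \<le> c * entry_max n (stage L U 0)"
  shows "lu_growth n L U \<le> c"
proof -
  have "{..<n} \<noteq> {}" using n by auto
  then have "Max ((\<lambda>k. entry_max n (stage L U k)) ` {..<n}) \<le> c * entry_max n (stage L U 0)"
    using n c by (subst Max_le_iff) (auto intro!: entry_max_le)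
  then show ?thesis
    unfolding lu_growth_def using entry_max_pos[OF pf n] by (simp add: pos_divide_le_eq)
qed

lemma lu_growth_ge_entry:
  assumes pf: "pivoted_factors n L U" and "k < n" "i < n" "j < n"
  shows "\<bar>stage L U k i j\<bar> / entry_max n (stage L U 0) \<le> lu_growth n L U"
proof -
  have "\<bar>stage L U k i j\<bar> \<le> entry_max n (stage L U k)" using assms by (intro entry_max_ge)
  also have "\<dots> \<le> Max ((\<lambda>k. entry_max n (stage L U k)) ` {..<n})"
    using assms by (intro Max_ge) auto
  finally show ?thesis
    unfolding lu_growth_def using entry_max_pos[OF pf] assms by (intro divide_right_mono) auto
qed

lemma stage_le_entry_max:
  assumes "pivoted_factors n L U" "k < n" "i < n" "j < n"
  shows "\<bar>stage L U k i j\<bar> \<le> 2 ^ k * entry_max n (stage L U 0)"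
  using stage_bound[OF assms(1) entry_max_ge[where X = "stage L U 0"]] assms(2-4) by blast

lemma lu_growth_le_power:
  assumes pf: "pivoted_factors n L U" and n: "0 < n"
  shows "lu_growth n L U \<le> 2 ^ (n - 1)"
proof (rule lu_growth_le_bound[OF pf n])
  fix k i j assume *: "k < n" "i < n" "j < n"
  have "\<bar>stage L U k i j\<bar> \<le> 2 ^ k * entry_max n (stage L U 0)"
    using stage_le_entry_max[OF pf] * by blast
  also have "\<dots> \<le> 2 ^ (n - 1) * entry_max n (stage L U 0)"
    using * entry_max_pos[OF pf n] by (intro mult_right_mono power_increasing) auto
  finally show "\<bar>stage L U k i j\<bar> \<le> 2 ^ (n - 1) * entry_max n (stage L U 0)" .
qed

lemma last_column_dominated:
  assumes pf: "pivoted_factors (Suc n) L U"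
  defines "a \<equiv> (\<lambda>k. \<bar>U n n * stage L U 0 (n - k) n\<bar>)"
  shows "a 0 = 1" "\<And>k. 0 < k \<Longrightarrow> k \<le> n \<Longrightarrow> a k \<le> (\<Sum>i<k. a i)"
    "(\<Sum>i\<le>n. (a i)\<^sup>2) = (U n n)\<^sup>2"
proof -
  note v = last_column_left_inverse[OF pf]
  show "a 0 = 1" using v(1) by (simp add: a_def)
  show "a k \<le> (\<Sum>i<k. a i)" if k: "0 < k" "k \<le> n" for k
  proof -
    have "a k = \<bar>\<Sum>i\<in>{n - k<..n}. U n n * stage L U 0 i n * L i (n - k)\<bar>"
      unfolding a_def using k by (subst v(2)) auto
    also have "\<dots> \<le> (\<Sum>i\<in>{n - k<..n}. \<bar>U n n * stage L U 0 i n\<bar>)"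
    proof (rule order_trans[OF sum_abs], rule sum_mono)
      fix i assume "i \<in> {n - k<..n}"
      then have "\<bar>L i (n - k)\<bar> \<le> 1" using pivoted_factorsD(2)[OF pf] by auto
      then show "\<bar>U n n * stage L U 0 i n * L i (n - k)\<bar> \<le> \<bar>U n n * stage L U 0 i n\<bar>"
        unfolding abs_mult[of _ "L i (n - k)"] by (intro mult_right_le_one_le) auto
    qed
    also have "\<dots> = (\<Sum>i<k. a i)"
      unfolding a_def using k
      by (intro sum.reindex_bij_witness[of _ "\<lambda>i. n - i" "\<lambda>i. n - i"]) auto
    finally show ?thesis .
  qed
  have "(\<Sum>i\<le>n. (a i)\<^sup>2) = (\<Sum>i\<le>n. (U n n * stage L U 0 i n)\<^sup>2)"
    unfolding a_def power2_abs
    by (intro sum.reindex_bij_witness[of _ "\<lambda>i. n - i" "\<lambda>i. n - i"]) auto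
  then show "(\<Sum>i\<le>n. (a i)\<^sup>2) = (U n n)\<^sup>2" using v(3) by simp
qed

text \<open>
  Before the last step entries have grown by at most \<open>2\<^bsup>n - 1\<^esup>\<close>, and the last step changes no entry
  except the last pivot \<open>u\<close>. With \<open>v = u q\<close> the last row of \<open>L\<inverse>\<close>, the largest entry of \<open>Q\<close> is at least
  \<open>max \<bar>v\<^sub>i\<bar> / \<bar>u\<bar>\<close>, and \<open>u\<^sup>2 = \<Sum> v\<^sub>i\<^sup>2\<close>; so \<open>u\<close> contributes at most \<open>(\<Sum> v\<^sub>i\<^sup>2) / max \<bar>v\<^sub>i\<bar>\<close> to the growth.
\<close>

lemma lu_growth_upper:
  assumes pf: "pivoted_factors (Suc n) L U" and n: "0 < n"
  shows "lu_growth (Suc n) L U \<le> 2 / 3 * (2 ^ n + 1)"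
proof (rule lu_growth_le_bound[OF pf])
  fix k i j assume *: "k < Suc n" "i < Suc n" "j < Suc n"
  define M where "M = entry_max (Suc n) (stage L U 0)"
  define X :: real where "X = 2 / 3 * (2 ^ n + 1)"
  have M: "0 < M" unfolding M_def by (intro entry_max_pos[OF pf]) simp
  obtain n' where n': "n = Suc n'" using n by (cases n) auto
  have small: "\<bar>stage L U k i j\<bar> \<le> X * M" if "k < n" "i < Suc n" for k i
  proof -
    have "\<bar>stage L U k i j\<bar> \<le> 2 ^ k * M"
      unfolding M_def using stage_le_entry_max[OF pf] * that by simp
    also have "\<dots> \<le> 2 ^ n' * M"
      using that M by (intro mult_right_mono power_increasing) (auto simp: n')
    also have "\<dots> \<le> X * M"
      using M by (intro mult_right_mono) (auto simp: X_def n')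
    finally show ?thesis .
  qed
  have un: "\<bar>U n n\<bar> \<le> X * M"
  proof -
    define a where "a k = \<bar>U n n * stage L U 0 (n - k) n\<bar>" for k
    note a = last_column_dominated[OF pf, folded a_def]
    have "Max (a ` {..n}) \<in> a ` {..n}" by (intro Max_in) auto
    then obtain m where m: "m \<le> n" "Max (a ` {..n}) = a m" by (elim imageE) auto
    have aM: "a k \<le> a m" if "k \<le> n" for k
      unfolding m(2)[symmetric] using that by (intro Max_ge) auto
    have a0: "0 \<le> a k" for k by (simp add: a_def)
    have "(U n n)\<^sup>2 \<le> a m * X"
      unfolding a(3)[symmetric] X_def
      by (rule dominated_sum_squares_upper[OF a(1) a0 a(2) aM m(1) refl n])
    also have "a m * X \<le> (\<bar>U n n\<bar> * M) * X"
      unfolding a_def abs_mult M_def X_def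
      by (intro mult_right_mono mult_left_mono entry_max_ge) auto
    finally have "\<bar>U n n\<bar> * \<bar>U n n\<bar> \<le> \<bar>U n n\<bar> * (X * M)"
      by (simp add: power2_eq_square mult_ac)
    moreover have "0 < \<bar>U n n\<bar>" using pivot_nonzero[OF pf, of n] by simp
    ultimately show ?thesis by (simp only: mult_le_cancel_left_pos)
  qed
  have "\<bar>stage L U k i j\<bar> \<le> X * M"
  proof (cases "k < n")
    case False
    then have k: "k = n" using * by simp
    have st: "stage L U n i j = U i j"
      using * pivoted_factorsD(1)[OF pf] by (intro stage_diag) auto
    consider "i < n" | "i = n" "j < n" | "i = n" "j = n" using * by linarith
    then show ?thesis
    proof cases
      case 1
      then have "stage L U n' i j = U i j"
        using * pivoted_factorsD(1)[OF pf] by (intro stage_diag) (auto simp: n')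
      then show ?thesis using small[of n' i] 1 st k by (simp add: n')
    next
      case 2
      then have "U n j = 0" using pivoted_factorsD(3)[OF pf, of n j] by simp
      then show ?thesis using st k 2 M by (simp add: X_def add_nonneg_nonneg)
    next
      case 3
      then show ?thesis using st k un by simp
    qed
  qed (use small * in simp)
  then show "\<bar>stage L U k i j\<bar> \<le> 2 / 3 * (2 ^ n + 1) * entry_max (Suc n) (stage L U 0)"
    unfolding X_def M_def .
qed simp

section \<open>Every admissible left factor occurs\<close>

text \<open>
  Orthogonal projection onto the span of \<open>f 0, \<dots>, f (j - 1)\<close>, without assuming independence.
\<close>

lemma projection_coefficients_exist:
  fixes f :: "nat \<Rightarrow> nat \<Rightarrow> real"
  shows "\<exists>c. \<forall>l<j. (\<Sum>i<n. (x i - (\<Sum>m<j. c m * f m i)) * f l i) = 0"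
proof (induction j arbitrary: x)
  case (Suc j)
  obtain c where c: "\<And>l. l < j \<Longrightarrow> (\<Sum>i<n. (x i - (\<Sum>m<j. c m * f m i)) * f l i) = 0"
    using Suc[of x] by blast
  obtain d where d: "\<And>l. l < j \<Longrightarrow> (\<Sum>i<n. (f j i - (\<Sum>m<j. d m * f m i)) * f l i) = 0"
    using Suc[of "f j"] by blast
  define x' where "x' i = x i - (\<Sum>m<j. c m * f m i)" for i
  define r where "r i = f j i - (\<Sum>m<j. d m * f m i)" for i
  \<comment> \<open>If \<open>r = 0\<close> then \<open>t = 0\<close> by the convention on division, which is the right coefficient.\<close>
  define t where "t = (\<Sum>i<n. x' i * f j i) / (\<Sum>i<n. r i * r i)"
  have fj: "(\<Sum>i<n. y i * f j i) = (\<Sum>i<n. y i * r i)"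
    if "\<And>l. l < j \<Longrightarrow> (\<Sum>i<n. y i * f l i) = 0" for y
  proof -
    have "(\<Sum>i<n. y i * (\<Sum>m<j. d m * f m i)) = (\<Sum>m<j. d m * (\<Sum>i<n. y i * f m i))"
      unfolding sum_distrib_left by (subst sum.swap) (simp add: mult_ac)
    also have "\<dots> = 0" using that by simp
    finally have "(\<Sum>i<n. y i * (\<Sum>m<j. d m * f m i)) = 0" .
    moreover have "(\<Sum>i<n. y i * f j i) = (\<Sum>i<n. y i * r i + y i * (\<Sum>m<j. d m * f m i))"
      by (intro sum.cong) (auto simp: r_def algebra_simps)
    ultimately show ?thesis by (simp add: sum.distrib)
  qed
  have x'r: "(\<Sum>i<n. x' i * f j i) = t * (\<Sum>i<n. r i * r i)"
  proof (cases "(\<Sum>i<n. r i * r i) = 0")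
    case True
    then have "\<And>i. i < n \<Longrightarrow> r i = 0" by (subst (asm) sum_nonneg_eq_0_iff) auto
    then show ?thesis using fj[of x'] c by (simp add: x'_def True)
  qed (simp add: t_def)
  define c' where "c' m = (if m < j then c m - t * d m else t)" for m
  have c': "x i - (\<Sum>m<Suc j. c' m * f m i) = x' i - t * r i" for i
    by (simp add: c'_def x'_def r_def algebra_simps sum_subtractf sum_distrib_left)
  have "(\<Sum>i<n. (x i - (\<Sum>m<Suc j. c' m * f m i)) * f l i) = 0" if "l < Suc j" for l
  proof -
    have "(\<Sum>i<n. (x' i - t * r i) * f l i)
        = (\<Sum>i<n. x' i * f l i) - t * (\<Sum>i<n. r i * f l i)"
      by (simp add: algebra_simps sum_subtractf sum_distrib_left)
    also have "\<dots> = 0"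
    proof (cases "l = j")
      case True
      then show ?thesis using x'r fj[of r] d by (simp add: r_def)
    next
      case False
      then show ?thesis using c[of l] d[of l] that by (simp add: x'_def r_def)
    qed
    finally show ?thesis unfolding c' .
  qed
  then show ?case by blast
qed simp

text \<open>
  Gram-Schmidt applied to the columns of \<open>L\<close>: the right factor is recovered from the coefficients.
  So an orthogonal matrix with large growth can be prescribed through its left factor alone.
\<close>

lemma orthogonal_factor_exists:
  assumes diag: "\<And>i. i < n \<Longrightarrow> L i i = 1" and le: "\<And>i j. i < n \<Longrightarrow> j < i \<Longrightarrow> \<bar>L i j\<bar> \<le> 1"
  shows "\<exists>U. pivoted_factors n L U"
proof -
  define f where "f l i = (if l \<le> i then L i l else 0)" for l i
  have "\<forall>j. \<exists>c. \<forall>l<j. (\<Sum>i<n. (f j i - (\<Sum>m<j. c m * f m i)) * f l i) = 0"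
    using projection_coefficients_exist by blast
  then obtain c where
    c: "\<And>j l. l < j \<Longrightarrow> (\<Sum>i<n. (f j i - (\<Sum>m<j. c j m * f m i)) * f l i) = 0"
    by metis
  define r where "r j i = f j i - (\<Sum>m<j. c j m * f m i)" for j i
  define N where "N j = sqrt (\<Sum>i<n. r j i * r j i)" for j
  define U where "U m j = (if m < j then - c j m else if m = j then 1 else 0) / N j" for m j
  \<comment> \<open>As \<open>L\<close> is unit lower triangular, the rows above \<open>j\<close> force all coefficients of a vanishing \<open>r j\<close> to be 0.\<close>
  have N0: "(\<Sum>i<n. r j i * r j i) \<noteq> 0" if j: "j < n" for j
  proof
    assume "(\<Sum>i<n. r j i * r j i) = 0"
    then have r0: "\<And>i. i < n \<Longrightarrow> r j i = 0" by (subst (asm) sum_nonneg_eq_0_iff) auto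
    have c0: "m < j \<Longrightarrow> c j m = 0" for m
    proof (induction m rule: less_induct)
      case (less m)
      have "(\<Sum>m'<j. c j m' * f m' m) = (\<Sum>m'<j. if m' = m then c j m else 0)"
        using less diag j by (intro sum.cong) (auto simp: f_def not_le)
      then show ?case using r0[of m] less.prems j by (simp add: r_def f_def)
    qed
    then have "r j j = 1" using diag j by (simp add: r_def f_def)
    then show False using r0 j by simp
  qed
  have N: "0 < N j" "N j * N j = (\<Sum>i<n. r j i * r j i)" if "j < n" for j
  proof -
    have "0 \<le> (\<Sum>i<n. r j i * r j i)" by (intro sum_nonneg) auto
    then show "0 < N j" "N j * N j = (\<Sum>i<n. r j i * r j i)"
      using N0[OF that] unfolding N_def by auto
  qed
  have Q: "stage L U 0 i j = r j i / N j" if "i < n" "j < n" for i j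
  proof -
    have "stage L U 0 i j = (\<Sum>l\<in>{0..i}. f l i * U l j)"
      by (simp add: stage_def f_def)
    also have "\<dots> = (\<Sum>l<n. f l i * U l j)"
      using that by (intro sum.mono_neutral_left) (auto simp: f_def)
    also have "\<dots> = (\<Sum>l\<in>{..<Suc j}. f l i * U l j)"
      using that by (intro sum.mono_neutral_right) (auto simp: U_def)
    also have "\<dots> = (f j i + (\<Sum>l<j. - c j l * f l i)) / N j"
      by (simp add: U_def add_divide_distrib sum_divide_distrib mult.commute)
    finally show ?thesis by (simp add: r_def sum_negf)
  qed
  have orth: "(\<Sum>i<n. r j i * r j' i) = 0" if "j' < j" for j j'
  proof -
    have "(\<Sum>i<n. r j i * (\<Sum>m<j'. c j' m * f m i)) = (\<Sum>m<j'. c j' m * (\<Sum>i<n. r j i * f m i))"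
      unfolding sum_distrib_left by (subst sum.swap) (simp add: mult_ac)
    also have "\<dots> = 0" using c[of _ j] that by (simp add: r_def)
    finally have "(\<Sum>i<n. r j i * (\<Sum>m<j'. c j' m * f m i)) = 0" .
    moreover have "(\<Sum>i<n. r j i * f j' i) = 0" using c[OF that] by (simp add: r_def)
    ultimately show ?thesis
      by (simp add: r_def[of j'] right_diff_distrib sum_subtractf)
  qed
  have "(\<Sum>i<n. stage L U 0 i j * stage L U 0 i j') = (if j = j' then 1 else 0)"
    if "j < n" "j' < n" for j j'
  proof -
    have "(\<Sum>i<n. stage L U 0 i j * stage L U 0 i j') = (\<Sum>i<n. r j i * r j' i) / (N j * N j')"
      unfolding sum_divide_distrib using that by (intro sum.cong) (auto simp: Q)
    also have "\<dots> = (if j = j' then 1 else 0)"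
    proof (cases "j = j'")
      case True
      then show ?thesis using N[OF that(1)] N0[OF that(1)] by simp
    next
      case False
      then have "(\<Sum>i<n. r j i * r j' i) = 0"
        using orth[of j' j] orth[of j j'] by (cases "j' < j") (auto simp: mult.commute)
      then show ?thesis using False by simp
    qed
    finally show ?thesis .
  qed
  then have "pivoted_factors n L U"
    using diag le by (auto simp: pivoted_factors_def U_def)
  then show ?thesis by blast
qed

section \<open>Partial pivoting and triangular factors\<close>

lemma max_abs_entry_eq:
  assumes "B \<in> carrier_mat n n" "0 < n"
  shows "max_abs_entry B = entry_max n (\<lambda>i j. B $$ (i, j))"
proof -
  have "abs ` elements_mat B = (\<lambda>(i, j). \<bar>B $$ (i, j)\<bar>) ` ({..<n} \<times> {..<n})"
  proof (intro equalityI subsetI)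
    fix x assume "x \<in> abs ` elements_mat B"
    then obtain e where "e \<in> elements_mat B" "x = \<bar>e\<bar>" by auto
    then show "x \<in> (\<lambda>(i, j). \<bar>B $$ (i, j)\<bar>) ` ({..<n} \<times> {..<n})"
      using elements_matD[of e B] assms by force
  next
    fix x assume "x \<in> (\<lambda>(i, j). \<bar>B $$ (i, j)\<bar>) ` ({..<n} \<times> {..<n})"
    then show "x \<in> abs ` elements_mat B"
      using elements_matI[OF assms(1)] by auto
  qed
  then show ?thesis unfolding max_abs_entry_def entry_max_def by simp
qed

lemma entry_max_cong:
  assumes "\<And>i j. i < n \<Longrightarrow> j < n \<Longrightarrow> X i j = Y i j"
  shows "entry_max n X = entry_max n Y"
  unfolding entry_max_def using assms by (intro arg_cong[of _ _ Max] image_cong) auto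

lemma entry_max_permute_rows:
  assumes "bij_betw \<sigma> {..<n} {..<n}"
  shows "entry_max n (\<lambda>i j. X (\<sigma> i) j) = entry_max n X"
proof -
  have "(\<lambda>(i, j). \<bar>X i j\<bar>) ` ({..<n} \<times> {..<n})
      = (\<lambda>(i, j). \<bar>X i j\<bar>) ` (map_prod \<sigma> id ` ({..<n} \<times> {..<n}))"
    using assms by (simp add: map_prod_surj_on bij_betw_def)
  also have "\<dots> = (\<lambda>(i, j). \<bar>X (\<sigma> i) j\<bar>) ` ({..<n} \<times> {..<n})"
    by (simp add: image_image case_prod_beta)
  finally show ?thesis unfolding entry_max_def by simp
qed

lemma pivot_ruleD:
  assumes "pivot_rule p" "B \<in> carrier_mat n n" "k < n"
  shows "k \<le> p k B" "p k B < n"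
    "\<And>i. k \<le> i \<Longrightarrow> i < n \<Longrightarrow> \<bar>B $$ (i, k)\<bar> \<le> \<bar>B $$ (p k B, k)\<bar>"
    "(\<And>i. k \<le> i \<Longrightarrow> i < n \<Longrightarrow> \<bar>B $$ (i, k)\<bar> \<le> \<bar>B $$ (k, k)\<bar>) \<Longrightarrow> p k B = k"
proof -
  have *: "p k B \<in> {k..<n} \<and>
     (\<forall>i \<in> {k..<n}. \<bar>B $$ (i, k)\<bar> \<le> \<bar>B $$ (p k B, k)\<bar>) \<and>
     ((\<forall>i \<in> {k..<n}. \<bar>B $$ (i, k)\<bar> \<le> \<bar>B $$ (k, k)\<bar>) \<longrightarrow> p k B = k)"
    using spec[OF spec[OF assms(1)[unfolded pivot_rule_def], of n], of k] assms(2,3) by simp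
  show "k \<le> p k B" "p k B < n" using * by auto
  show "\<bar>B $$ (i, k)\<bar> \<le> \<bar>B $$ (p k B, k)\<bar>" if "k \<le> i" "i < n" for i using * that by simp
  show "p k B = k" if "\<And>i. k \<le> i \<Longrightarrow> i < n \<Longrightarrow> \<bar>B $$ (i, k)\<bar> \<le> \<bar>B $$ (k, k)\<bar>"
    using * that by simp
qed

lemma gepp_carrier: "A \<in> carrier_mat n n \<Longrightarrow> gepp p A k \<in> carrier_mat n n"
  by (induction k) (auto simp: eliminate_below_def Let_def)

text \<open>
  For a row that is still being eliminated, only the first \<open>k\<close> columns of \<open>L\<close> and the diagonal matter.
\<close>

lemma stage_pending:
  assumes "L i i = 1" "\<And>l. k \<le> l \<Longrightarrow> l < i \<Longrightarrow> L i l = 0" "k' \<le> k" "k \<le> i"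
  shows "stage L M k' i j = M i j + (\<Sum>l\<in>{k'..<k}. L i l * M l j)"
proof -
  have "stage L M k' i j = (\<Sum>l\<in>{k'..<k} \<union> {i}. L i l * M l j)"
    unfolding stage_def using assms by (intro sum.mono_neutral_right) auto
  then show ?thesis using assms by (simp add: sum.union_disjoint)
qed

text \<open>
  The state of the elimination after \<open>k\<close> steps: \<open>\<pi>\<close> collects the row swaps made so far, \<open>M\<close> is the
  current matrix, and \<open>L\<close> holds the multipliers of the first \<open>k\<close> steps, its remaining columns being
  those of the identity.
\<close>

definition partial_factorization ::
  "nat \<Rightarrow> real mat \<Rightarrow> nat \<Rightarrow> (nat \<Rightarrow> nat) \<Rightarrow> (nat \<Rightarrow> nat \<Rightarrow> real) \<Rightarrow> (nat \<Rightarrow> nat \<Rightarrow> real) \<Rightarrow> bool" where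
  "partial_factorization n A k \<pi> L M \<longleftrightarrow>
     bij_betw \<pi> {..<n} {..<n} \<and> (\<forall>i<n. L i i = 1) \<and>
     (\<forall>i<n. \<forall>j<i. \<bar>L i j\<bar> \<le> 1 \<and> (k \<le> j \<longrightarrow> L i j = 0)) \<and>
     (\<forall>i<n. \<forall>j<min i k. M i j = 0) \<and>
     (\<forall>i<n. \<forall>j<n. A $$ (\<pi> i, j) = stage L M 0 i j)"

text \<open>
  Swapping two rows that are not finished permutes the rows of all the earlier matrices too. So the
  earlier matrices keep their sets of entries when the swaps are all carried out in advance.
\<close>

lemma partial_factorization_swap:
  assumes pf: "partial_factorization n A k \<pi> L M" and r: "k \<le> r" "r < n"
    and \<sigma>_def: "\<sigma> = Transposition.transpose k r"
    and L'_def: "L' = (\<lambda>i l. if l < k then L (\<sigma> i) l else if l = i then 1 else 0)"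
    and M'_def: "M' = (\<lambda>i. M (\<sigma> i))"
  shows "partial_factorization n A k (\<pi> \<circ> \<sigma>) L' M'"
    and "\<And>k' i j. k' \<le> k \<Longrightarrow> i < n \<Longrightarrow>
      stage L' M' k' i j = stage L M k' (\<sigma> i) j"
    and "bij_betw \<sigma> {..<n} {..<n}"
proof -
  note pf = pf[unfolded partial_factorization_def]
  have \<sigma>: "\<sigma> i < n" if "i < n" for i using that r by (auto simp: \<sigma>_def transpose_def)
  have \<sigma>lo: "\<sigma> i = i" if "i < k" for i using that r by (auto simp: \<sigma>_def transpose_def)
  have \<sigma>hi: "k \<le> \<sigma> i" if "k \<le> i" for i using that r by (auto simp: \<sigma>_def transpose_def)
  show bij: "bij_betw \<sigma> {..<n} {..<n}"
    using r unfolding \<sigma>_def bij_betw_def by simp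
  show st: "stage L' M' k' i j = stage L M k' (\<sigma> i) j" if "k' \<le> k" "i < n" for k' i j
  proof (cases "i < k")
    case True
    then show ?thesis
      unfolding stage_def \<sigma>lo[OF True] by (intro sum.cong) (auto simp: L'_def M'_def \<sigma>lo)
  next
    case False
    have "stage L' M' k' i j = M' i j + (\<Sum>l\<in>{k'..<k}. L' i l * M' l j)"
      using False that pf by (intro stage_pending) (auto simp: L'_def)
    also have "\<dots> = M (\<sigma> i) j + (\<Sum>l\<in>{k'..<k}. L (\<sigma> i) l * M l j)"
      by (auto simp: L'_def M'_def \<sigma>lo)
    also have "\<dots> = stage L M k' (\<sigma> i) j"
      using False that pf \<sigma> \<sigma>hi by (intro stage_pending[symmetric]) auto
    finally show ?thesis .
  qed
  have "\<bar>L' i j\<bar> \<le> 1 \<and> (k \<le> j \<longrightarrow> L' i j = 0)" if "i < n" "j < i" for i j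
  proof (cases "j < k")
    case True
    have "j < \<sigma> i" using \<sigma>lo[of i] \<sigma>hi[of i] True that by (cases "i < k") auto
    then show ?thesis using pf \<sigma>[OF that(1)] True by (simp add: L'_def)
  qed (use that in \<open>simp add: L'_def\<close>)
  moreover have "L' i i = 1" if "i < n" for i
    using that pf by (simp add: L'_def \<sigma>lo)
  moreover have "M' i j = 0" if "i < n" "j < min i k" for i j
  proof -
    have "j < min (\<sigma> i) k" using \<sigma>lo[of i] \<sigma>hi[of i] that by (cases "i < k") auto
    then show ?thesis unfolding M'_def using pf \<sigma>[OF that(1)] by blast
  qed
  moreover have "A $$ ((\<pi> \<circ> \<sigma>) i, j) = stage L' M' 0 i j" if "i < n" "j < n" for i j
    using st[of 0 i j] that pf \<sigma> by simp
  moreover have "bij_betw (\<pi> \<circ> \<sigma>) {..<n} {..<n}"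
    using bij_betw_trans[OF bij] pf by blast
  ultimately show "partial_factorization n A k (\<pi> \<circ> \<sigma>) L' M'"
    unfolding partial_factorization_def by blast
qed

lemma partial_factorization_eliminate:
  assumes pf: "partial_factorization n A k \<pi> L M" and k: "k < n"
    and piv: "\<forall>i. k < i \<longrightarrow> i < n \<longrightarrow> \<bar>M i k\<bar> \<le> \<bar>M k k\<bar>"
    and L'_def: "L' = (\<lambda>i l. if l = k \<and> k < i then M i k / M k k else L i l)"
    and M'_def: "M' = (\<lambda>i j. if k < i then M i j - M i k / M k k * M k j else M i j)"
  shows "partial_factorization n A (Suc k) \<pi> L' M'"
    and "\<And>k' i j. k' \<le> k \<Longrightarrow> i < n \<Longrightarrow> stage L' M' k' i j = stage L M k' i j"
    and "\<And>i j. i < n \<Longrightarrow> stage L' M' (Suc k) i j = M' i j"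
proof -
  note pf = pf[unfolded partial_factorization_def]
  have pend: "stage L' M' k' i j = M' i j + (\<Sum>l\<in>{k'..<Suc k}. L' i l * M' l j)"
    if "k' \<le> Suc k" "i < n" "k < i" for k' i j
    using that pf by (intro stage_pending) (auto simp: L'_def)
  show st: "stage L' M' k' i j = stage L M k' i j" if "k' \<le> k" "i < n" for k' i j
  proof (cases "k < i")
    case True
    have "stage L' M' k' i j = M' i j + (\<Sum>l\<in>{k'..<k}. L i l * M l j) + M i k / M k k * M k j"
      using pend[of k' i j] True that by (simp add: L'_def M'_def)
    also have "\<dots> = M i j + (\<Sum>l\<in>{k'..<k}. L i l * M l j)"
      using True by (simp add: M'_def)
    also have "\<dots> = stage L M k' i j"
      using True that pf by (intro stage_pending[symmetric]) auto
    finally show ?thesis .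
  next
    case False
    then show ?thesis
      unfolding stage_def by (intro sum.cong) (auto simp: L'_def M'_def)
  qed
  show "stage L' M' (Suc k) i j = M' i j" if "i < n" for i j
  proof (cases "k < i")
    case True
    then show ?thesis using pend[of "Suc k" i j] that by simp
  next
    case False
    then show ?thesis using pf that by (intro stage_diag) (auto simp: L'_def)
  qed
  have "\<bar>L' i j\<bar> \<le> 1 \<and> (Suc k \<le> j \<longrightarrow> L' i j = 0)" if "i < n" "j < i" for i j
  proof (cases "j = k")
    case True
    \<comment> \<open>A zero pivot means that the column is zero below; the multipliers are then 0 as well.\<close>
    have "\<bar>M i k\<bar> / \<bar>M k k\<bar> \<le> 1"
      using piv that True by (cases "M k k = 0") (auto simp: divide_le_eq_1)
    then show ?thesis using True that by (simp add: L'_def)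
  qed (use that pf in \<open>simp add: L'_def\<close>)
  moreover have "L' i i = 1" if "i < n" for i using that pf by (simp add: L'_def)
  moreover have "M' i j = 0" if "i < n" "j < min i (Suc k)" for i j
  proof (cases "k < i")
    case True
    show ?thesis
    proof (cases "j = k")
      case True
      then show ?thesis using piv that by (cases "M k k = 0") (auto simp: M'_def)
    next
      case False
      then have "j < min i k" "j < min k k" using that True by auto
      then have "M i j = 0" "M k j = 0" using pf that k by blast+
      then show ?thesis by (simp add: M'_def)
    qed
  next
    case False
    then show ?thesis using that pf by (simp add: M'_def)
  qed
  moreover have "A $$ (\<pi> i, j) = stage L' M' 0 i j" if "i < n" "j < n" for i j
    using st[of 0 i j] that pf by simp
  moreover have "bij_betw \<pi> {..<n} {..<n}" using pf by blast
  ultimately show "partial_factorization n A (Suc k) \<pi> L' M'"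
    unfolding partial_factorization_def by blast
qed

text \<open>
  Each intermediate matrix is recovered, up to the order of its rows, from the current factors; so the
  factors at the end of the elimination determine the maximal entries of all of them.
\<close>

lemma gepp_partial_factorization:
  assumes p: "pivot_rule p" and A: "A \<in> carrier_mat n n"
  shows "k < n \<Longrightarrow> \<exists>\<pi> L M. partial_factorization n A k \<pi> L M \<and>
    (\<forall>i<n. \<forall>j<n. gepp p A k $$ (i, j) = M i j) \<and>
    (\<forall>k'\<le>k. max_abs_entry (gepp p A k') = entry_max n (stage L M k'))"
proof (induction k)
  case 0
  define L :: "nat \<Rightarrow> nat \<Rightarrow> real" where "L i l = (if i = l then 1 else 0)" for i l
  have st: "stage L (\<lambda>i j. A $$ (i, j)) 0 i j = A $$ (i, j)" for i j
  proof -
    have "stage L (\<lambda>i j. A $$ (i, j)) 0 i j = (\<Sum>l\<in>{0..i}. if l = i then A $$ (i, j) else 0)"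
      unfolding stage_def L_def by (intro sum.cong) auto
    then show ?thesis by simp
  qed
  have "partial_factorization n A 0 (\<lambda>i. i) L (\<lambda>i j. A $$ (i, j))"
    unfolding partial_factorization_def
    by (simp add: st bij_betw_def) (simp add: L_def)
  moreover have "max_abs_entry (gepp p A 0) = entry_max n (stage L (\<lambda>i j. A $$ (i, j)) 0)"
    using 0 A by (simp add: max_abs_entry_eq st cong: entry_max_cong)
  ultimately show ?case
    by - (rule exI[of _ "\<lambda>i. i"], rule exI[of _ L], rule exI[of _ "\<lambda>i j. A $$ (i, j)"], simp)
next
  case (Suc k)
  obtain \<pi> L M where IH: "partial_factorization n A k \<pi> L M \<and>
      (\<forall>i<n. \<forall>j<n. gepp p A k $$ (i, j) = M i j) \<and>
      (\<forall>k'\<le>k. max_abs_entry (gepp p A k') = entry_max n (stage L M k'))"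
    using Suc.IH[OF Suc_lessD[OF Suc.prems]] by (elim exE) (rule that)
  then have pf: "partial_factorization n A k \<pi> L M" by blast
  have M: "\<And>i j. i < n \<Longrightarrow> j < n \<Longrightarrow> gepp p A k $$ (i, j) = M i j"
    and mx: "\<And>k'. k' \<le> k \<Longrightarrow> max_abs_entry (gepp p A k') = entry_max n (stage L M k')"
    using IH by blast+
  define B where "B = gepp p A k"
  have B: "B \<in> carrier_mat n n" using gepp_carrier[OF A] by (simp add: B_def)
  define r where "r = p k B"
  have kn: "k < n" using Suc by simp
  have r: "k \<le> r" "r < n" "\<And>i. k \<le> i \<Longrightarrow> i < n \<Longrightarrow> \<bar>B $$ (i, k)\<bar> \<le> \<bar>B $$ (r, k)\<bar>"
    using pivot_ruleD(1-3)[OF p B kn] unfolding r_def by auto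
  define \<sigma> where "\<sigma> = Transposition.transpose k r"
  define M' where "M' = (\<lambda>i. M (\<sigma> i))"
  define L' where "L' = (\<lambda>i l. if l < k then L (\<sigma> i) l else if l = i then 1 else 0)"
  note sw = partial_factorization_swap[OF pf r(1,2) \<sigma>_def L'_def M'_def]
  have \<sigma>n: "\<sigma> i < n" "k \<le> \<sigma> i" if "k \<le> i" "i < n" for i
    using that r by (auto simp: \<sigma>_def transpose_def)
  have "\<bar>M' i k\<bar> \<le> \<bar>M' k k\<bar>" if "k < i" "i < n" for i
    using r(3)[of "\<sigma> i"] \<sigma>n[of i] that r(2) kn by (simp add: M'_def M B_def) (simp add: \<sigma>_def)
  then have piv: "\<forall>i. k < i \<longrightarrow> i < n \<longrightarrow> \<bar>M' i k\<bar> \<le> \<bar>M' k k\<bar>" by blast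
  define L'' where "L'' = (\<lambda>i l. if l = k \<and> k < i then M' i k / M' k k else L' i l)"
  define M'' where "M'' = (\<lambda>i j. if k < i then M' i j - M' i k / M' k k * M' k j else M' i j)"
  note el = partial_factorization_eliminate[OF sw(1) kn piv L''_def M''_def]
  define S where "S = swaprows k r B"
  have S: "S \<in> carrier_mat n n" using B by (simp add: S_def)
  have sB: "S $$ (i, j) = M' i j" if "i < n" "j < n" for i j
    using that B r kn
    by (auto simp: S_def M'_def \<sigma>_def transpose_def M[symmetric] B_def[symmetric])
  have ES: "gepp p A (Suc k) = eliminate_below k S"
    by (simp add: Let_def B_def S_def r_def)
  have G: "gepp p A (Suc k) $$ (i, j) = M'' i j" if "i < n" "j < n" for i j
    unfolding ES using that kn S by (simp add: eliminate_below_def M''_def sB)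
  have mx': "max_abs_entry (gepp p A k') = entry_max n (stage L'' M'' k')" if "k' \<le> Suc k" for k'
  proof (cases "k' = Suc k")
    case True
    have "max_abs_entry (gepp p A (Suc k)) = entry_max n (\<lambda>i j. gepp p A (Suc k) $$ (i, j))"
      using kn by (intro max_abs_entry_eq gepp_carrier[OF A]) simp
    also have "\<dots> = entry_max n (stage L'' M'' (Suc k))"
      by (rule entry_max_cong) (simp only: G el(3))
    finally show ?thesis unfolding True .
  next
    case False
    then have k': "k' \<le> k" using that by simp
    have "entry_max n (stage L'' M'' k') = entry_max n (\<lambda>i j. stage L M k' (\<sigma> i) j)"
      by (rule entry_max_cong) (simp only: el(2)[OF k'] sw(2)[OF k'])
    also have "\<dots> = entry_max n (stage L M k')"
      by (rule entry_max_permute_rows[OF sw(3)])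
    finally show ?thesis unfolding mx[OF k'] by (rule sym)
  qed
  show ?case
    by (rule exI[of _ "\<pi> \<circ> \<sigma>"], rule exI[of _ L''], rule exI[of _ M''])
      (intro conjI allI impI el(1) G mx')
qed

text \<open>
  Permuting the rows of an orthogonal matrix in advance makes all swaps superfluous, without changing
  the growth factor.
\<close>

lemma gepp_growth_factors:
  assumes p: "pivot_rule p" and A: "A \<in> orthogonal_group n" and n: "0 < n"
  shows "\<exists>L U. pivoted_factors n L U \<and> gepp_growth p A = lu_growth n L U"
proof -
  have Ac: "A \<in> carrier_mat n n" and AA: "transpose_mat A * A = 1\<^sub>m n"
    using A by (auto simp: orthogonal_group_def)
  have last: "n - 1 < n" using n by simp
  obtain \<pi> L U where PF: "partial_factorization n A (n - 1) \<pi> L U \<and>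
      (\<forall>i<n. \<forall>j<n. gepp p A (n - 1) $$ (i, j) = U i j) \<and>
      (\<forall>k'\<le>n - 1. max_abs_entry (gepp p A k') = entry_max n (stage L U k'))"
    using gepp_partial_factorization[OF p Ac last] by (elim exE) (rule that)
  then have pf: "partial_factorization n A (n - 1) \<pi> L U" by blast
  have mx: "\<And>k'. k' \<le> n - 1 \<Longrightarrow> max_abs_entry (gepp p A k') = entry_max n (stage L U k')"
    using PF by blast
  note pf = pf[unfolded partial_factorization_def]
  have "(\<Sum>i<n. stage L U 0 i j * stage L U 0 i j') = (if j = j' then 1 else 0)"
    if j: "j < n" "j' < n" for j j'
  proof -
    have "(\<Sum>i<n. stage L U 0 i j * stage L U 0 i j') = (\<Sum>i<n. A $$ (\<pi> i, j) * A $$ (\<pi> i, j'))"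
      using pf j by (intro sum.cong) auto
    also have "\<dots> = (\<Sum>i<n. A $$ (i, j) * A $$ (i, j'))"
      using pf by (intro sum.reindex_bij_betw[of \<pi>]) auto
    also have "\<dots> = (transpose_mat A * A) $$ (j, j')"
      using Ac j by (simp add: scalar_prod_def lessThan_atLeast0)
    finally show ?thesis using j by (simp add: AA)
  qed
  moreover have "U i j = 0" if "i < n" "j < i" for i j
  proof -
    have "j < min i (n - 1)" using that by auto
    moreover have "\<forall>i<n. \<forall>j<min i (n - 1). U i j = 0" using pf by blast
    ultimately show ?thesis using that by blast
  qed
  moreover have "\<forall>i<n. L i i = 1" "\<forall>i<n. \<forall>j<i. \<bar>L i j\<bar> \<le> 1" using pf by blast+
  ultimately have "pivoted_factors n L U"
    unfolding pivoted_factors_def by blast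
  moreover have "gepp_growth p A = lu_growth n L U"
  proof -
    have "(\<lambda>k. max_abs_entry (gepp p A k)) ` {..<n} = (\<lambda>k. entry_max n (stage L U k)) ` {..<n}"
      using mx by (intro image_cong) auto
    moreover have "max_abs_entry A = entry_max n (stage L U 0)" using mx[of 0] by simp
    ultimately show ?thesis using Ac by (simp add: gepp_growth_def lu_growth_def)
  qed
  ultimately show ?thesis by blast
qed

text \<open>
  Conversely, if \<open>\<bar>L\<^sub>i\<^sub>j\<bar> \<le> 1\<close> then at each step the diagonal entry is already of maximal modulus in its
  column, and every pivot rule must leave the rows alone. This is why ties do not matter.
\<close>

lemma gepp_of_factors:
  assumes p: "pivot_rule p" and pf: "pivoted_factors n L U"
  shows "k < n \<Longrightarrow> gepp p (mat n n (\<lambda>(i, j). stage L U 0 i j)) k = mat n n (\<lambda>(i, j). stage L U k i j)"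
proof (induction k)
  case (Suc k)
  define B where "B = mat n n (\<lambda>(i, j). stage L U k i j)"
  have B: "B \<in> carrier_mat n n" by (simp add: B_def)
  have kn: "k < n" using Suc by simp
  have col: "stage L U k i k = L i k * U k k" if "k \<le> i" "i < n" for i
    using pivoted_factorsD(3)[OF pf] that by (intro stage_column) auto
  have diag: "stage L U k k k = U k k" using col[of k] kn pivoted_factorsD(1)[OF pf kn] by simp
  have "\<bar>B $$ (i, k)\<bar> \<le> \<bar>B $$ (k, k)\<bar>" if "k \<le> i" "i < n" for i
  proof -
    have "\<bar>L i k\<bar> \<le> 1"
      using that pivoted_factorsD(1,2)[OF pf] by (cases "i = k") auto
    then have "\<bar>L i k\<bar> * \<bar>U k k\<bar> \<le> \<bar>U k k\<bar>" by (intro mult_left_le_one_le) auto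
    then show ?thesis using that col[of i] diag by (simp add: B_def abs_mult)
  qed
  then have pk: "p k B = k"
    by (rule pivot_ruleD(4)[OF p B kn])
  have "swaprows k k B = B" by (rule eq_matI) (auto simp: mat_swaprows_def)
  then have "gepp p (mat n n (\<lambda>(i, j). stage L U 0 i j)) (Suc k) = eliminate_below k B"
    using Suc.IH kn by (simp add: B_def[symmetric] Let_def pk)
  also have "\<dots> = mat n n (\<lambda>(i, j). stage L U (Suc k) i j)"
  proof (rule eq_matI)
    fix i j assume "i < dim_row (mat n n (\<lambda>(i, j). stage L U (Suc k) i j))"
      "j < dim_col (mat n n (\<lambda>(i, j). stage L U (Suc k) i j))"
    then have ij: "i < n" "j < n" by auto
    have "k < i \<Longrightarrow> stage L U k i k / stage L U k k k = L i k"
      using col[of i] diag ij pivot_nonzero[OF pf kn] by simp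
    then show "eliminate_below k B $$ (i, j) = mat n n (\<lambda>(i, j). stage L U (Suc k) i j) $$ (i, j)"
      using ij kn by (simp add: eliminate_below_def B_def stage_Suc pivoted_factorsD(1)[OF pf])
  qed (auto simp: eliminate_below_def B_def)
  finally show ?case .
qed simp

lemma factors_gepp_growth:
  assumes p: "pivot_rule p" and pf: "pivoted_factors n L U" and n: "0 < n"
  shows "\<exists>A \<in> orthogonal_group n. gepp_growth p A = lu_growth n L U"
proof -
  define A where "A = mat n n (\<lambda>(i, j). stage L U 0 i j)"
  have A: "A \<in> orthogonal_group n"
    unfolding orthogonal_group_def A_def
    using pivoted_factorsD(4)[OF pf]
    by (auto intro!: eq_matI simp: scalar_prod_def lessThan_atLeast0)
  have "max_abs_entry (gepp p A k) = entry_max n (stage L U k)" if "k < n" for k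
    using n gepp_of_factors[OF p pf that]
    by (simp add: A_def max_abs_entry_eq[of _ n] cong: entry_max_cong)
  then have "(\<lambda>k. max_abs_entry (gepp p A k)) ` {..<n} = (\<lambda>k. entry_max n (stage L U k)) ` {..<n}"
    "max_abs_entry (gepp p A 0) = entry_max n (stage L U 0)"
    using n by (auto intro!: image_cong simp del: gepp.simps)
  then have "gepp_growth p A = lu_growth n L U"
    using n by (simp add: gepp_growth_def lu_growth_def A_def)
  then show ?thesis using A by blast
qed

section \<open>The maximum is attained and does not depend on the pivot rule\<close>

text \<open>
  The two bounds concern all indices, also those outside the matrix: they make this a subset of a
  product of compact intervals. Changing factors outside their triangles gives a representative of
  every pair of factors, since \<open>\<bar>U\<^sub>i\<^sub>j\<bar> \<le> 2\<^sup>i\<close> holds inside.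
\<close>

definition factor_set :: "nat \<Rightarrow> ((nat \<Rightarrow> nat \<Rightarrow> real) \<times> (nat \<Rightarrow> nat \<Rightarrow> real)) set" where
  "factor_set n = {x. pivoted_factors n (fst x) (snd x) \<and>
     (\<forall>i j. \<bar>fst x i j\<bar> \<le> 1) \<and> (\<forall>i j. \<bar>snd x i j\<bar> \<le> 2 ^ n)}"

lemma orthogonal_entry_le_1:
  assumes "pivoted_factors n L U" "i < n" "j < n"
  shows "\<bar>stage L U 0 i j\<bar> \<le> 1"
proof -
  have "(stage L U 0 i j)\<^sup>2 \<le> (\<Sum>i<n. (stage L U 0 i j)\<^sup>2)"
    using assms by (intro member_le_sum) auto
  also have "\<dots> = 1"
    using pivoted_factorsD(4)[OF assms(1), of j j] assms(3) by (simp add: power2_eq_square)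
  finally show ?thesis by (simp add: abs_square_le_1)
qed

lemma factor_set_representative:
  assumes pf: "pivoted_factors n L U"
  shows "\<exists>x \<in> factor_set n. lu_growth n (fst x) (snd x) = lu_growth n L U"
proof -
  define L' where "L' i j = (if i < n \<and> j \<le> i then L i j else 0)" for i j
  define U' where "U' i j = (if i < n \<and> j < n then U i j else 0)" for i j
  have st: "stage L' U' k i j = stage L U k i j" if "i < n" "j < n" for k i j
    unfolding stage_def using that by (intro sum.cong) (auto simp: L'_def U'_def)
  have pf': "pivoted_factors n L' U'"
    using pf unfolding pivoted_factors_def by (simp add: st) (simp add: L'_def U'_def)
  have "\<bar>L' i j\<bar> \<le> 1" for i j
    using pivoted_factorsD(1,2)[OF pf] by (cases "i = j") (auto simp: L'_def)
  moreover have "\<bar>U' i j\<bar> \<le> 2 ^ n" for i j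
  proof (cases "i < n \<and> j < n")
    case True
    then have "\<bar>stage L U i i j\<bar> \<le> 2 ^ i * 1"
      using stage_bound[OF pf orthogonal_entry_le_1[OF pf]] by blast
    also have "\<dots> \<le> 2 ^ n" using True by simp
    finally show ?thesis
      using True pivoted_factorsD(1)[OF pf] by (simp add: U'_def stage_diag)
  qed (auto simp: U'_def)
  ultimately have "(L', U') \<in> factor_set n" using pf' by (simp add: factor_set_def)
  moreover have "lu_growth n L' U' = lu_growth n L U"
    unfolding lu_growth_def using st by (simp cong: entry_max_cong)
  ultimately show ?thesis by force
qed

lemma compact_box:
  "compact {f :: nat \<Rightarrow> nat \<Rightarrow> real. \<forall>i j. \<bar>f i j\<bar> \<le> c}"
proof -
  have tychonoff: "compact (PiE UNIV (\<lambda>_::nat. S))" if "compact S" for S :: "'b::topological_space set"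
  proof -
    have "compactin (product_topology (\<lambda>_::nat. euclidean) UNIV) (PiE UNIV (\<lambda>_. S))"
      using that by (simp add: compactin_PiE)
    then show ?thesis by (simp add: euclidean_product_topology)
  qed
  have "{f :: nat \<Rightarrow> nat \<Rightarrow> real. \<forall>i j. \<bar>f i j\<bar> \<le> c} = PiE UNIV (\<lambda>_. PiE UNIV (\<lambda>_. {-c..c}))"
    by (auto simp: PiE_def Pi_def abs_le_iff) (metis minus_le_iff)+
  then show ?thesis by (simp add: tychonoff)
qed

lemma closed_Collect_ball:
  "(\<And>i. i \<in> I \<Longrightarrow> closed {x. P i x}) \<Longrightarrow> closed {x. \<forall>i\<in>I. P i x}"
  by (simp add: Collect_ball_eq closed_INT)

lemma continuous_on_entry:
  fixes S :: "((nat \<Rightarrow> nat \<Rightarrow> real) \<times> (nat \<Rightarrow> nat \<Rightarrow> real)) set"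
  shows "continuous_on S (\<lambda>x. fst x i j)" "continuous_on S (\<lambda>x. snd x i j)"
proof -
  have *: "continuous_on S fst" "continuous_on S snd"
    by (rule continuous_on_fst[OF continuous_on_id] continuous_on_snd[OF continuous_on_id])+
  show "continuous_on S (\<lambda>x. fst x i j)" "continuous_on S (\<lambda>x. snd x i j)"
    by (rule continuous_on_product_then_coordinatewise,
        rule continuous_on_product_then_coordinatewise, rule *)+
qed

lemma continuous_on_stage:
  fixes S :: "((nat \<Rightarrow> nat \<Rightarrow> real) \<times> (nat \<Rightarrow> nat \<Rightarrow> real)) set"
  shows "continuous_on S (\<lambda>x. stage (fst x) (snd x) k i j)"
  unfolding stage_def by (intro continuous_on_sum continuous_on_mult continuous_on_entry)

lemma continuous_on_Max_image:
  fixes f :: "'i \<Rightarrow> 'a::topological_space \<Rightarrow> real"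
  assumes "finite I" "I \<noteq> {}" "\<And>i. i \<in> I \<Longrightarrow> continuous_on S (f i)"
  shows "continuous_on S (\<lambda>x. Max ((\<lambda>i. f i x) ` I))"
  using assms
proof (induction rule: finite_ne_induct)
  case (insert i I)
  then show ?case by (simp add: continuous_on_max)
qed simp

lemma continuous_on_entry_max_stage:
  fixes S :: "((nat \<Rightarrow> nat \<Rightarrow> real) \<times> (nat \<Rightarrow> nat \<Rightarrow> real)) set"
  assumes "0 < n"
  shows "continuous_on S (\<lambda>x. entry_max n (stage (fst x) (snd x) k))"
proof -
  have "continuous_on S (\<lambda>x. Max ((\<lambda>(i, j). \<bar>stage (fst x) (snd x) k i j\<bar>) ` ({..<n} \<times> {..<n})))"
    unfolding case_prod_beta using assms
    by (intro continuous_on_Max_image continuous_on_rabs continuous_on_stage) auto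
  then show ?thesis unfolding entry_max_def .
qed

text \<open>
  Growth under a fixed pivot rule is discontinuous where ties occur. In terms of the factors it is a
  continuous function on this compact set.
\<close>

lemma compact_factor_set: "compact (factor_set n)"
proof -
  define box where "box = {f :: nat \<Rightarrow> nat \<Rightarrow> real. \<forall>i j. \<bar>f i j\<bar> \<le> 1} \<times>
      {f :: nat \<Rightarrow> nat \<Rightarrow> real. \<forall>i j. \<bar>f i j\<bar> \<le> 2 ^ n}"
  define C where "C = {x :: (nat \<Rightarrow> nat \<Rightarrow> real) \<times> (nat \<Rightarrow> nat \<Rightarrow> real).
     (\<forall>i\<in>{..<n}. fst x i i = 1) \<and> (\<forall>i\<in>{..<n}. \<forall>j\<in>{..<i}. \<bar>fst x i j\<bar> \<le> 1) \<and>
     (\<forall>i\<in>{..<n}. \<forall>j\<in>{..<i}. snd x i j = 0) \<and>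
     (\<forall>j\<in>{..<n}. \<forall>j'\<in>{..<n}. (\<Sum>i<n. stage (fst x) (snd x) 0 i j * stage (fst x) (snd x) 0 i j')
        = (if j = j' then 1 else 0))}"
  have "closed C"
    unfolding C_def
    by (intro closed_Collect_conj closed_Collect_ball closed_Collect_eq closed_Collect_le
        continuous_on_sum continuous_on_mult continuous_on_rabs continuous_on_const
        continuous_on_entry continuous_on_stage)
  moreover have "compact box" unfolding box_def by (intro compact_Times compact_box)
  moreover have "factor_set n = box \<inter> C"
    by (auto simp: factor_set_def box_def C_def pivoted_factors_def)
  ultimately show ?thesis by (simp add: compact_Int_closed)
qed

lemma factor_set_nonempty: "factor_set n \<noteq> {}"
proof -
  obtain U where "pivoted_factors n (\<lambda>i j. if i = j then 1 else 0) U"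
    using orthogonal_factor_exists[of n "\<lambda>i j. if i = j then 1 else 0"] by auto
  then show ?thesis using factor_set_representative by blast
qed

lemma lu_growth_attains_max:
  assumes n: "0 < n"
  shows "\<exists>x \<in> factor_set n. \<forall>y \<in> factor_set n.
    lu_growth n (fst y) (snd y) \<le> lu_growth n (fst x) (snd x)"
proof (rule continuous_attains_sup[OF compact_factor_set factor_set_nonempty])
  have ne: "{..<n} \<noteq> {}" using n by auto
  have "entry_max n (stage (fst x) (snd x) 0) \<noteq> 0" if "x \<in> factor_set n" for x
    using entry_max_pos[OF _ n] that unfolding factor_set_def by fastforce
  then show "continuous_on (factor_set n) (\<lambda>x. lu_growth n (fst x) (snd x))"
    unfolding lu_growth_def using ne
    by (intro continuous_on_divide continuous_on_Max_image continuous_on_entry_max_stage n ballI) auto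
qed

definition max_lu_growth :: "nat \<Rightarrow> real" where
  "max_lu_growth n = (SUP x \<in> factor_set n. lu_growth n (fst x) (snd x))"

lemma max_lu_growth_ge:
  assumes "pivoted_factors n L U" "0 < n"
  shows "lu_growth n L U \<le> max_lu_growth n"
proof -
  obtain z where "\<And>y. y \<in> factor_set n \<Longrightarrow>
      lu_growth n (fst y) (snd y) \<le> lu_growth n (fst z) (snd z)"
    using lu_growth_attains_max[OF assms(2)] by blast
  then have bdd: "bdd_above ((\<lambda>x. lu_growth n (fst x) (snd x)) ` factor_set n)"
    by (rule bdd_aboveI2)
  obtain x where "x \<in> factor_set n" "lu_growth n (fst x) (snd x) = lu_growth n L U"
    using factor_set_representative[OF assms(1)] by blast
  then show ?thesis
    using cSUP_upper[OF _ bdd, of x] unfolding max_lu_growth_def by simp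
qed

lemma max_lu_growth_le:
  assumes "\<And>L U. pivoted_factors n L U \<Longrightarrow> lu_growth n L U \<le> c"
  shows "max_lu_growth n \<le> c"
  unfolding max_lu_growth_def using assms factor_set_nonempty
  by (intro cSUP_least) (auto simp: factor_set_def)

lemma gepp_growth_image:
  assumes p: "pivot_rule p" and n: "0 < n"
  shows "gepp_growth p ` orthogonal_group n = (\<lambda>x. lu_growth n (fst x) (snd x)) ` factor_set n"
proof (intro equalityI subsetI)
  fix y assume "y \<in> gepp_growth p ` orthogonal_group n"
  then obtain A where A: "A \<in> orthogonal_group n" "y = gepp_growth p A" by blast
  obtain L U where LU: "pivoted_factors n L U" "gepp_growth p A = lu_growth n L U"
    using gepp_growth_factors[OF p A(1) n] by (elim exE conjE) (rule that)
  obtain x where "x \<in> factor_set n" "lu_growth n (fst x) (snd x) = lu_growth n L U"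
    using factor_set_representative[OF LU(1)] by (elim bexE) (rule that)
  then show "y \<in> (\<lambda>x. lu_growth n (fst x) (snd x)) ` factor_set n"
    using A(2) LU(2) by (intro image_eqI[of _ _ x]) simp_all
next
  fix y assume "y \<in> (\<lambda>x. lu_growth n (fst x) (snd x)) ` factor_set n"
  then obtain x where x: "x \<in> factor_set n" "y = lu_growth n (fst x) (snd x)" by (elim imageE) simp
  have "pivoted_factors n (fst x) (snd x)" using x(1) by (simp add: factor_set_def)
  from factors_gepp_growth[OF p this n]
  obtain A where "A \<in> orthogonal_group n" "gepp_growth p A = lu_growth n (fst x) (snd x)"
    by (elim bexE) (rule that)
  then show "y \<in> gepp_growth p ` orthogonal_group n"
    using x(2) by (intro image_eqI[of _ _ A]) simp_all
qed

lemma max_gepp_growth_eq: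
  assumes "pivot_rule p" "0 < n"
  shows "max_gepp_growth p (orthogonal_group n) = max_lu_growth n"
  unfolding max_gepp_growth_def max_lu_growth_def gepp_growth_image[OF assms] ..

lemma gepp_growth_attains_max:
  assumes p: "pivot_rule p" and n: "0 < n"
  shows "\<exists>A \<in> orthogonal_group n. gepp_growth p A = max_gepp_growth p (orthogonal_group n) \<and>
    (\<forall>B \<in> orthogonal_group n. gepp_growth p B \<le> gepp_growth p A)"
proof -
  obtain x where x: "x \<in> factor_set n"
    "\<And>y. y \<in> factor_set n \<Longrightarrow> lu_growth n (fst y) (snd y) \<le> lu_growth n (fst x) (snd x)"
    using lu_growth_attains_max[OF n] by blast
  have "lu_growth n (fst x) (snd x) \<in> gepp_growth p ` orthogonal_group n"
    unfolding gepp_growth_image[OF p n] using x(1) by (rule imageI)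
  then obtain A where A: "A \<in> orthogonal_group n" "gepp_growth p A = lu_growth n (fst x) (snd x)"
    by (elim imageE) simp
  have le: "gepp_growth p B \<le> gepp_growth p A" if "B \<in> orthogonal_group n" for B
  proof -
    have "gepp_growth p B \<in> (\<lambda>x. lu_growth n (fst x) (snd x)) ` factor_set n"
      unfolding gepp_growth_image[OF p n, symmetric] using that by (rule imageI)
    then show ?thesis using x(2) unfolding A(2) by (elim imageE) simp
  qed
  have "gepp_growth p A = max_gepp_growth p (orthogonal_group n)"
    unfolding max_gepp_growth_def using A(1) le by (intro cSup_eq_maximum[symmetric]) auto
  then show ?thesis using A(1) le by blast
qed

lemma max_lu_growth_1: "max_lu_growth 1 = 1"
proof (rule antisym)
  show "max_lu_growth 1 \<le> 1" using lu_growth_le_power[of 1] by (intro max_lu_growth_le) simp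
  have pf: "pivoted_factors 1 (\<lambda>_ _. 1) (\<lambda>_ _. 1)"
    by (simp add: pivoted_factors_def stage_def)
  have "\<bar>stage (\<lambda>_ _. 1) (\<lambda>_ _. 1) 0 0 0\<bar> / entry_max 1 (stage (\<lambda>_ _. 1) (\<lambda>_ _. 1) 0) \<le> max_lu_growth 1"
    using lu_growth_ge_entry[OF pf, of 0 0 0] max_lu_growth_ge[OF pf] by simp
  moreover have "entry_max 1 (stage (\<lambda>_ _. 1) (\<lambda>_ _. 1) 0) = 1"
    by (simp add: entry_max_def stage_def lessThan_Suc)
  ultimately show "1 \<le> max_lu_growth 1" by (simp add: stage_def)
qed

lemma max_lu_growth_2: "max_lu_growth 2 = 2"
proof (rule antisym)
  show "max_lu_growth 2 \<le> 2" using lu_growth_le_power[of 2] by (intro max_lu_growth_le) simp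
  define L :: "nat \<Rightarrow> nat \<Rightarrow> real" where "L i j = (if j < i then - 1 else 1)" for i j
  define U :: "nat \<Rightarrow> nat \<Rightarrow> real" where
    "U i j = (if i = 0 then 1 / sqrt 2 else if j = 0 then 0 else sqrt 2)" for i j
  have Q: "stage L U 0 0 j = 1 / sqrt 2" "stage L U 0 (Suc 0) 0 = - 1 / sqrt 2"
    "stage L U 0 (Suc 0) (Suc 0) = 1 / sqrt 2" for j
    by (auto simp: stage_def L_def U_def field_simps)
  have all2: "(\<forall>i<2. P i) \<longleftrightarrow> P 0 \<and> P (Suc 0)" for P :: "nat \<Rightarrow> bool"
    by (auto simp: less_2_cases_iff)
  have pf: "pivoted_factors 2 L U"
    unfolding pivoted_factors_def all2
    by (simp add: Q numeral_2_eq_2) (simp add: L_def U_def)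
  have "\<bar>stage L U 0 i j\<bar> \<le> 1 / sqrt 2" if "i < 2" "j < 2" for i j
    using that by (auto simp: less_2_cases_iff Q)
  then have "entry_max 2 (stage L U 0) \<le> 1 / sqrt 2" by (intro entry_max_le) auto
  then have "sqrt 2 / (1 / sqrt 2) \<le> \<bar>stage L U 1 1 1\<bar> / entry_max 2 (stage L U 0)"
    using entry_max_pos[OF pf] by (intro frac_le) (auto simp: stage_def L_def U_def)
  also have "\<dots> \<le> max_lu_growth 2"
    using lu_growth_ge_entry[OF pf, of 1 1 1] max_lu_growth_ge[OF pf] by simp
  finally show "2 \<le> max_lu_growth 2" by simp
qed

section \<open>A flat orthogonal matrix and a band of weights\<close>

text \<open>
  The discrete Hartley transform: a real symmetric orthogonal matrix of any size \<open>b\<close> all of whose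
  entries are of order \<open>1 / \<surd>b\<close>, with constant first column.
\<close>

definition hartley :: "nat \<Rightarrow> nat \<Rightarrow> nat \<Rightarrow> real" where
  "hartley b i k = (cos (2 * pi * i * k / b) + sin (2 * pi * i * k / b)) / sqrt b"

lemma hartley_commute: "hartley b i k = hartley b k i"
  by (simp add: hartley_def mult_ac)

lemma hartley_0: "hartley b i 0 = 1 / sqrt b"
  by (simp add: hartley_def)

lemma abs_hartley_le: "\<bar>hartley b i k\<bar> \<le> sqrt (2 / b)"
proof -
  define x where "x = 2 * pi * i * k / b"
  have "(cos x + sin x)\<^sup>2 + (cos x - sin x)\<^sup>2 = 2 * ((sin x)\<^sup>2 + (cos x)\<^sup>2)"
    by (simp add: power2_eq_square algebra_simps)
  then have "(cos x + sin x)\<^sup>2 + (cos x - sin x)\<^sup>2 = 2"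
    by simp
  then have "(cos x + sin x)\<^sup>2 \<le> 2"
    using zero_le_power2[of "cos x - sin x"] by linarith
  then have "\<bar>cos x + sin x\<bar> \<le> sqrt 2"
    using real_le_rsqrt by (metis power2_abs)
  then show ?thesis
    unfolding hartley_def x_def[symmetric] by (simp add: real_sqrt_divide divide_right_mono)
qed

lemma sum_cis_roots:
  assumes "cis \<theta> ^ b = 1" "cis \<theta> \<noteq> 1"
  shows "(\<Sum>k<b. cis (\<theta> * real k)) = 0"
proof -
  have "(\<Sum>k<b. cis (\<theta> * real k)) = (\<Sum>k<b. cis \<theta> ^ k)"
    by (simp add: DeMoivre mult.commute)
  also have "\<dots> = 0" using assms by (simp add: geometric_sum)
  finally show ?thesis .
qed

lemma hartley_orthonormal:
  assumes "i < b" "j < b"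
  shows "(\<Sum>k<b. hartley b i k * hartley b j k) = (if i = j then 1 else 0)"
proof -
  have b: "0 < b" using assms by simp
  define \<theta> where "\<theta> = 2 * pi * (real i - real j) / b"
  define \<phi> where "\<phi> = 2 * pi * (real i + real j) / b"
  have prod: "(cos x + sin x) * (cos y + sin y) = cos (x - y) + sin (x + y)" for x y :: real
    by (simp add: cos_diff sin_add algebra_simps)
  have summand: "hartley b i k * hartley b j k = (Re (cis (\<theta> * k)) + Im (cis (\<phi> * k))) / b" for k
  proof -
    have "2 * pi * i * k / b - 2 * pi * j * k / b = \<theta> * k"
      "2 * pi * i * k / b + 2 * pi * j * k / b = \<phi> * k"
      by (simp_all add: \<theta>_def \<phi>_def algebra_simps add_divide_distrib diff_divide_distrib)
    then show ?thesis
      using b by (simp add: hartley_def prod)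
  qed
  have "cis \<phi> ^ b = cis (2 * pi * real (i + j))" using b by (simp add: DeMoivre \<phi>_def)
  also have "\<dots> = cis (2 * pi) ^ (i + j)" by (simp add: DeMoivre mult.commute del: cis_2pi)
  finally have \<phi>b: "cis \<phi> ^ b = 1" by simp
  have \<phi>: "Im (\<Sum>k<b. cis (\<phi> * k)) = 0"
  proof (cases "cis \<phi> = 1")
    case True
    have "cis (\<phi> * real k) = cis \<phi> ^ k" for k by (simp add: DeMoivre mult.commute)
    then show ?thesis using True by simp
  qed (simp add: sum_cis_roots[OF \<phi>b])
  have \<theta>: "(\<Sum>k<b. cis (\<theta> * k)) = (if i = j then of_nat b else 0)"
  proof (cases "i = j")
    case True
    then show ?thesis by (simp add: \<theta>_def)
  next
    case False
    have "real b * \<theta> = 2 * pi * i - 2 * pi * j"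
      using b by (simp add: \<theta>_def field_simps)
    then have "cis \<theta> ^ b = cis (2 * pi * i - 2 * pi * j)"
      by (simp add: DeMoivre)
    also have "\<dots> = cis (2 * pi) ^ i / cis (2 * pi) ^ j"
      by (simp add: DeMoivre cis_divide mult.commute del: cis_2pi)
    finally have \<theta>b: "cis \<theta> ^ b = 1" by simp
    have "cis \<theta> \<noteq> 1"
    proof
      assume "cis \<theta> = 1"
      then have "cos \<theta> = 1" by (metis cis.simps(1) one_complex.simps(1))
      then obtain m :: int where "\<theta> = of_int m * 2 * pi" using cos_one_2pi_int by blast
      then have "(2 * pi) * (real i - real j) = (2 * pi) * (of_int m * b)"
        using b by (simp add: \<theta>_def field_simps)
      then have "real i - real j = of_int m * b" by (subst (asm) mult_left_cancel) auto
      then have "real_of_int (int i - int j) = real_of_int (m * int b)" by simp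
      then have m: "int i - int j = m * int b" by (simp only: of_int_eq_iff)
      have "\<bar>m * int b\<bar> < int b" using assms unfolding m[symmetric] by auto
      then have "\<bar>m\<bar> * int b < 1 * int b" by (simp add: abs_mult)
      then have "\<bar>m\<bar> < 1" using b by (simp only: mult_less_cancel_right)
      then have "m = 0" by simp
      then show False using m False by simp
    qed
    then show ?thesis using False by (simp add: sum_cis_roots[OF \<theta>b])
  qed
  have "(\<Sum>k<b. hartley b i k * hartley b j k)
      = (Re (\<Sum>k<b. cis (\<theta> * k)) + Im (\<Sum>k<b. cis (\<phi> * k))) / b"
    unfolding summand by (simp add: sum.distrib add_divide_distrib sum_divide_distrib)
  then show ?thesis using \<theta> \<phi> b by simp
qed

text \<open>
  The sequence solving \<open>w\<^sub>N = 1 + w\<^bsub>N-1\<^esub> + \<dots> + w\<^bsub>N-K\<^esub>\<close>. Summing over all predecessors would give \<open>2\<^sup>N\<close>;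
  summing over the last \<open>K\<close> of them loses only a proportion \<open>N / 2\<^bsup>K+1\<^esup>\<close>.
\<close>

fun band_weight :: "nat \<Rightarrow> nat \<Rightarrow> real" where
  "band_weight K N = 1 + (\<Sum>i\<in>{N - K..<N}. band_weight K i)"

declare band_weight.simps [simp del]

lemma band_weight_ge_1: "1 \<le> band_weight K N"
proof (induction N rule: less_induct)
  case (less N)
  have "0 \<le> (\<Sum>i\<in>{N - K..<N}. band_weight K i)"
    using less by (intro sum_nonneg) force
  then show ?case by (subst band_weight.simps) simp
qed

lemma band_weight_le: "band_weight K N \<le> 2 ^ N"
proof (induction N rule: less_induct)
  case (less N)
  have "(\<Sum>i\<in>{N - K..<N}. band_weight K i) \<le> (\<Sum>i\<in>{N - K..<N}. 2 ^ i)"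
    using less by (intro sum_mono) auto
  also have "\<dots> \<le> (\<Sum>i<N. 2 ^ i)" by (intro sum_mono2) auto
  also have "\<dots> = 2 ^ N - (1::real)" by (simp add: geometric_sum)
  finally show ?case by (subst band_weight.simps) simp
qed

lemma band_weight_lower:
  assumes "0 < K"
  shows "(1 - real N / 2 ^ Suc K) * 2 ^ N \<le> band_weight K N"
proof (induction N)
  case 0
  then show ?case using band_weight_ge_1 by simp
next
  case (Suc N)
  have "2 * band_weight K N - 2 ^ N / 2 ^ K \<le> band_weight K (Suc N)"
  proof (cases "K \<le> N")
    case True
    have "{N - K..<N} = insert (N - K) {Suc N - K..<N}" "{Suc N - K..<Suc N} = insert N {Suc N - K..<N}"
      using True assms by auto
    then have "band_weight K (Suc N) = 2 * band_weight K N - band_weight K (N - K)"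
      using band_weight.simps[of K N] band_weight.simps[of K "Suc N"] True assms by simp
    moreover have "band_weight K (N - K) \<le> 2 ^ N / 2 ^ K"
      using band_weight_le[of K "N - K"] True by (simp add: power_diff)
    ultimately show ?thesis by simp
  next
    case False
    then have "N - K = 0" "Suc N - K = 0" by auto
    then show ?thesis
      using band_weight.simps[of K N] band_weight.simps[of K "Suc N"] by simp
  qed
  moreover have "(1 - real (Suc N) / 2 ^ Suc K) * 2 ^ Suc N
      = 2 * ((1 - real N / 2 ^ Suc K) * 2 ^ N) - 2 ^ N / 2 ^ K"
    by (simp add: field_simps)
  ultimately show ?case using Suc by linarith
qed

definition doubling :: "nat \<Rightarrow> real" where
  "doubling k = (if k = 0 then 1 else 2 ^ (k - 1))"

lemma sum_doubling: "(\<Sum>i<Suc k. doubling i) = 2 ^ k"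
  by (induction k) (auto simp: doubling_def)

lemma doubling_eq_sum: "0 < k \<Longrightarrow> doubling k = (\<Sum>i<k. doubling i)"
  using sum_doubling[of "k - 1"] by (cases k) (auto simp: doubling_def)

section \<open>A nearly extremal orthogonal matrix\<close>

lemma cauchy_schwarz_2:
  fixes p q r s :: real
  shows "(p * q + r * s)\<^sup>2 \<le> (p\<^sup>2 + r\<^sup>2) * (q\<^sup>2 + s\<^sup>2)"
  using zero_le_power2[of "p * s - r * q"] by (simp add: power2_eq_square algebra_simps)

lemma sum_squares_orthonormal_combination:
  fixes h :: "nat \<Rightarrow> nat \<Rightarrow> real"
  assumes "\<And>k l. k < m \<Longrightarrow> l < m \<Longrightarrow> (\<Sum>r<b. h r k * h r l) = (if k = l then 1 else 0)"
  shows "(\<Sum>r<b. (\<Sum>k<m. h r k * x k)\<^sup>2) = (\<Sum>k<m. (x k)\<^sup>2)"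
proof -
  have "(\<Sum>r<b. (\<Sum>k<m. h r k * x k)\<^sup>2)
      = (\<Sum>r<b. \<Sum>k<m. \<Sum>l<m. x k * x l * (h r k * h r l))"
    by (simp add: power2_eq_square sum_product mult_ac)
  also have "\<dots> = (\<Sum>k<m. \<Sum>r<b. \<Sum>l<m. x k * x l * (h r k * h r l))"
    by (rule sum.swap)
  also have "\<dots> = (\<Sum>k<m. \<Sum>l<m. \<Sum>r<b. x k * x l * (h r k * h r l))"
    by (rule sum.cong[OF refl], rule sum.swap)
  also have "\<dots> = (\<Sum>k<m. \<Sum>l<m. x k * x l * (\<Sum>r<b. h r k * h r l))"
    by (simp add: sum_distrib_left)
  also have "\<dots> = (\<Sum>k<m. \<Sum>l<m. if l = k then (x k)\<^sup>2 else 0)"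
    using assms by (intro sum.cong) (auto simp: power2_eq_square)
  finally show ?thesis by simp
qed

lemma orthogonal_decomposition:
  fixes x w :: "nat \<Rightarrow> real"
  assumes "(\<Sum>k<a. (w k)\<^sup>2) \<noteq> 0"
  defines "t \<equiv> (\<Sum>k<a. x k * w k) / (\<Sum>k<a. (w k)\<^sup>2)"
  shows "(\<Sum>k<a. (x k)\<^sup>2) = t\<^sup>2 * (\<Sum>k<a. (w k)\<^sup>2) + (\<Sum>k<a. (x k - t * w k)\<^sup>2)"
proof -
  have t: "(\<Sum>k<a. x k * w k) = t * (\<Sum>k<a. (w k)\<^sup>2)" using assms by simp
  have "(\<Sum>k<a. (x k - t * w k)\<^sup>2)
      = (\<Sum>k<a. (x k)\<^sup>2) - 2 * t * (\<Sum>k<a. x k * w k) + t\<^sup>2 * (\<Sum>k<a. (w k)\<^sup>2)"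
    by (simp add: power2_eq_square algebra_simps sum.distrib sum_subtractf sum_distrib_left)
  then show ?thesis unfolding t by (simp add: power2_eq_square)
qed

lemma cauchy_schwarz_sum:
  fixes f g :: "nat \<Rightarrow> real"
  shows "(\<Sum>k<a. f k * g k)\<^sup>2 \<le> (\<Sum>k<a. (f k)\<^sup>2) * (\<Sum>k<a. (g k)\<^sup>2)"
proof (cases "(\<Sum>k<a. (g k)\<^sup>2) = 0")
  case True
  then have "\<forall>k<a. g k = 0" by (subst (asm) sum_nonneg_eq_0_iff) auto
  then show ?thesis by simp
next
  case False
  define G where "G = (\<Sum>k<a. (g k)\<^sup>2)"
  define t where "t = (\<Sum>k<a. f k * g k) / G"
  have "0 \<le> G" unfolding G_def by (intro sum_nonneg) auto
  have P: "(\<Sum>k<a. f k * g k) = t * G" using False by (simp add: t_def G_def)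
  have "0 \<le> (\<Sum>k<a. (f k - t * g k)\<^sup>2)" by (intro sum_nonneg) auto
  then have "t\<^sup>2 * G \<le> (\<Sum>k<a. (f k)\<^sup>2)"
    using orthogonal_decomposition[OF False, of f] unfolding t_def G_def by linarith
  then have "t\<^sup>2 * G * G \<le> (\<Sum>k<a. (f k)\<^sup>2) * G"
    using \<open>0 \<le> G\<close> by (rule mult_right_mono)
  then show ?thesis unfolding P G_def[symmetric] by (simp add: power2_eq_square mult_ac)
qed

text \<open>
  The left factor has the block form with rows \<open>(A, 0)\<close> and \<open>(B, C)\<close>, where \<open>A\<close> has size \<open>a\<close> and \<open>C\<close> has
  size \<open>b\<close>. For growth all entries below the diagonal should be \<open>-1\<close>, but then some columns of \<open>Q\<close> have
  entries close to 1. A small perturbation of \<open>B\<close>, which costs little growth, cures this: \<open>B = G A\<close> with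
  \<open>G = - (1 - \<eta>) 1 w\<^sup>T + H\<close>, where \<open>w\<^sup>T A = 1\<^sup>T\<close> and the columns of \<open>H\<close> are orthonormal, flat and orthogonal
  to \<open>1\<close>. Thus \<open>B\<close> is close to the matrix of all \<open>-1\<close>, while \<open>H\<close> spreads each of the first columns of
  \<open>Q\<close> evenly over the two blocks, and likewise each of the others. In \<open>A\<close> the entries \<open>-1\<close> fill only a band
  of width \<open>K\<close> below the diagonal. This keeps the columns of \<open>A\<close> short, which makes \<open>H A\<close> small, while
  the omitted entries have a weight of order \<open>2\<^bsup>-K\<^esup>\<close> in the last row of \<open>L\<inverse>\<close>.
\<close>

locale two_block =
  fixes a b K :: nat
  assumes a: "2 \<le> a" and b: "Suc a \<le> b" and K: "0 < K"
    and flat: "real (Suc K) * sqrt (2 / b) \<le> 1"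
begin

text \<open>
  A bound for the entries of \<open>H A\<close>; shrinking the rank one part of \<open>B\<close> by it keeps \<open>\<bar>B\<^sub>i\<^sub>j\<bar> \<le> 1\<close>.
\<close>

definition \<eta> :: real where "\<eta> = real (Suc K) * sqrt (2 / b)"

definition w :: "nat \<Rightarrow> real" where "w i = band_weight K (a - Suc i)"

definition band_block :: "nat \<Rightarrow> nat \<Rightarrow> real" where
  "band_block i j = (if i = j then 1 else if j < i \<and> i \<le> j + K then - 1 else 0)"

text \<open>
  The matrix \<open>G\<close>. Column 0 of the Hartley matrix is constant; the next \<open>a\<close> columns form \<open>H\<close>.
\<close>

definition link :: "nat \<Rightarrow> nat \<Rightarrow> real" where
  "link r k = - (1 - \<eta>) * w k + hartley b r (Suc k)"

definition left_factor :: "nat \<Rightarrow> nat \<Rightarrow> real" where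
  "left_factor i j =
     (if i < a then band_block i j
      else if j < a then (\<Sum>k<a. link (i - a) k * band_block k j)
      else if i = j then 1 else if j < i then - 1 else 0)"

text \<open>
  The last row of \<open>L\<inverse>\<close>: its lower part is the last row of \<open>C\<inverse>\<close>, namely \<open>\<dots>, 4, 2, 1, 1\<close>, and its upper
  part is obtained from the lower one by applying \<open>- G\<^sup>T\<close>, since \<open>B A\<inverse> = G\<close>.
\<close>

definition last_inverse_row :: "nat \<Rightarrow> real" where
  "last_inverse_row i = (if i < a then - (\<Sum>r<b. link r i * doubling (b - Suc r)) else doubling (a + b - Suc i))"

lemma \<eta>: "0 \<le> \<eta>" "\<eta> \<le> 1" "sqrt (2 / b) \<le> \<eta>"
  using flat by (auto simp: \<eta>_def algebra_simps)

lemma w_pos: "1 \<le> w i" unfolding w_def by (rule band_weight_ge_1)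

lemma sum_w_band_block: 
  assumes j: "j < a"
  shows "(\<Sum>k<a. w k * band_block k j) = 1"
proof -
  have "(\<Sum>k<a. w k * band_block k j) = (\<Sum>k\<in>insert j {k. j < k \<and> k < a \<and> k \<le> j + K}. w k * band_block k j)"
    using j by (intro sum.mono_neutral_right) (auto simp: band_block_def)
  also have "\<dots> = w j + (\<Sum>k\<in>{k. j < k \<and> k < a \<and> k \<le> j + K}. w k * band_block k j)"
    by (subst sum.insert) (auto simp: band_block_def)
  also have "(\<Sum>k\<in>{k. j < k \<and> k < a \<and> k \<le> j + K}. w k * band_block k j)
      = (\<Sum>k\<in>{k. j < k \<and> k < a \<and> k \<le> j + K}. - w k)"
    by (intro sum.cong) (auto simp: band_block_def)
  also have "\<dots> = (\<Sum>i\<in>{a - Suc j - K..<a - Suc j}. - band_weight K i)"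
    unfolding w_def
    by (intro sum.reindex_bij_witness[of _ "\<lambda>i. a - Suc i" "\<lambda>k. a - Suc k"]) auto
  also have "w j = 1 + (\<Sum>i\<in>{a - Suc j - K..<a - Suc j}. band_weight K i)"
    unfolding w_def by (rule band_weight.simps)
  finally show ?thesis by (simp add: sum_negf)
qed

lemma abs_hartley_band_block_le:
  assumes j: "j < a"
  shows "\<bar>\<Sum>k<a. hartley b r (Suc k) * band_block k j\<bar> \<le> \<eta>"
proof -
  have "\<bar>\<Sum>k<a. hartley b r (Suc k) * band_block k j\<bar> \<le> (\<Sum>k<a. \<bar>hartley b r (Suc k) * band_block k j\<bar>)"
    by (rule sum_abs)
  also have "\<dots> \<le> (\<Sum>k<a. if k \<in> {j..j + K} then sqrt (2 / b) else 0)"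
    using abs_hartley_le[of b r] by (intro sum_mono) (auto simp: band_block_def)
  also have "\<dots> = real (card ({..<a} \<inter> {j..j + K})) * sqrt (2 / b)"
    by (subst sum.inter_restrict[symmetric]) auto
  also have "\<dots> \<le> real (Suc K) * sqrt (2 / b)"
  proof (intro mult_right_mono)
    have "card ({..<a} \<inter> {j..j + K}) \<le> card {j..j + K}" by (intro card_mono) auto
    then show "real (card ({..<a} \<inter> {j..j + K})) \<le> real (Suc K)" by simp
  qed simp
  finally show ?thesis unfolding \<eta>_def .
qed

lemma left_factor_bounds:
  shows "left_factor i i = 1" "j < i \<Longrightarrow> \<bar>left_factor i j\<bar> \<le> 1" "i < j \<Longrightarrow> left_factor i j = 0"
proof -
  show "left_factor i i = 1" by (simp add: left_factor_def band_block_def)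
  show "left_factor i j = 0" if "i < j" using that by (simp add: left_factor_def band_block_def)
  show "\<bar>left_factor i j\<bar> \<le> 1" if "j < i"
  proof (cases "i < a \<or> a \<le> j")
    case True
    then show ?thesis by (auto simp: left_factor_def band_block_def)
  next
    case False
    then have ij: "\<not> i < a" "j < a" by auto
    have "left_factor i j
        = - (1 - \<eta>) * (\<Sum>k<a. w k * band_block k j) + (\<Sum>k<a. hartley b (i - a) (Suc k) * band_block k j)"
      using ij by (simp add: left_factor_def link_def algebra_simps sum.distrib sum_subtractf
          sum_negf sum_distrib_left)
    moreover have "\<bar>\<Sum>k<a. hartley b (i - a) (Suc k) * band_block k j\<bar> \<le> \<eta>"
      by (rule abs_hartley_band_block_le[OF ij(2)])
    ultimately show ?thesis
      using \<eta> unfolding sum_w_band_block[OF ij(2)] abs_le_iff by simp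
  qed
qed

lemma sum_split: "(\<Sum>i<a + b. f i) = (\<Sum>i<a. f i) + (\<Sum>r<b. f (a + r))" for f :: "nat \<Rightarrow> real"
  by (induction b) auto

text \<open>
  Orthogonality of a vector \<open>(x, y)\<close> to the first \<open>a\<close> columns of \<open>L\<close> is \<open>(x + G\<^sup>T y)\<^sup>T A = 0\<close>, that is
  \<open>x = - G\<^sup>T y\<close>.
\<close>

lemma sum_left_factor_column:
  assumes m: "m < a"
  shows "(\<Sum>i\<in>{m..<a + b}. x i * left_factor i m)
    = (\<Sum>k<a. (x k + (\<Sum>r<b. link r k * x (a + r))) * band_block k m)"
proof -
  have "(\<Sum>i\<in>{m..<a + b}. x i * left_factor i m) = (\<Sum>i<a + b. x i * left_factor i m)"
    using left_factor_bounds(3) by (intro sum.mono_neutral_left) auto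
  also have "\<dots> = (\<Sum>k<a. x k * band_block k m) + (\<Sum>r<b. x (a + r) * (\<Sum>k<a. link r k * band_block k m))"
    using m by (simp add: sum_split left_factor_def)
  also have "(\<Sum>r<b. x (a + r) * (\<Sum>k<a. link r k * band_block k m))
      = (\<Sum>k<a. (\<Sum>r<b. link r k * x (a + r)) * band_block k m)"
    unfolding sum_distrib_left sum_distrib_right
    by (subst sum.swap) (simp add: mult_ac)
  finally show ?thesis by (simp add: distrib_right sum.distrib)
qed

lemma band_block_injective:
  assumes "\<And>m. m < a \<Longrightarrow> (\<Sum>k<a. z k * band_block k m) = 0"
  shows "m < a \<Longrightarrow> z m = 0"
proof (induction "a - m" arbitrary: m rule: less_induct)
  case less
  have "(\<Sum>k<a. z k * band_block k m) = (\<Sum>k<a. if k = m then z m else 0)"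
  proof (rule sum.cong[OF refl])
    fix k assume "k \<in> {..<a}"
    then show "z k * band_block k m = (if k = m then z m else 0)"
      using less.hyps[of k] less.prems by (cases "m < k") (auto simp: band_block_def)
  qed
  then show ?case using assms less.prems by simp
qed

lemma last_inverse_row_recursion:
  assumes "Suc m < a + b"
  shows "last_inverse_row m = - (\<Sum>i\<in>{m<..<a + b}. last_inverse_row i * left_factor i m)"
proof (cases "m < a")
  case True
  have "{m..<a + b} = insert m {m<..<a + b}" using assms by auto
  then have "(\<Sum>i\<in>{m..<a + b}. last_inverse_row i * left_factor i m)
      = last_inverse_row m + (\<Sum>i\<in>{m<..<a + b}. last_inverse_row i * left_factor i m)"
    using left_factor_bounds(1) by simp
  moreover have "(\<Sum>i\<in>{m..<a + b}. last_inverse_row i * left_factor i m) = 0"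
    unfolding sum_left_factor_column[OF True] by (simp add: last_inverse_row_def)
  ultimately show ?thesis by simp
next
  case False
  have "(\<Sum>i\<in>{m<..<a + b}. last_inverse_row i * left_factor i m)
      = (\<Sum>i\<in>{m<..<a + b}. - doubling (a + b - Suc i))"
    using False by (intro sum.cong) (auto simp: last_inverse_row_def left_factor_def)
  also have "\<dots> = (\<Sum>k<a + b - Suc m. - doubling k)"
    by (intro sum.reindex_bij_witness[of _ "\<lambda>k. a + b - Suc k" "\<lambda>i. a + b - Suc i"]) auto
  also have "\<dots> = - doubling (a + b - Suc m)"
    using assms doubling_eq_sum[of "a + b - Suc m"] by (simp add: sum_negf)
  finally show ?thesis using False by (simp add: last_inverse_row_def)
qed

lemma last_inverse_row_lower:
  assumes i: "i < a"
  shows "2 ^ (b - 1) * ((1 - \<eta>) * w i - sqrt (2 / b)) \<le> last_inverse_row i"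
proof -
  have s: "(\<Sum>r<b. doubling (b - Suc r)) = 2 ^ (b - 1)"
  proof -
    have "(\<Sum>r<b. doubling (b - Suc r)) = (\<Sum>k<b. doubling k)"
      by (rule sum.nat_diff_reindex)
    then show ?thesis using sum_doubling[of "b - 1"] b by simp
  qed
  have d: "0 \<le> doubling k" for k by (simp add: doubling_def)
  have "(\<Sum>r<b. hartley b r (Suc i) * doubling (b - Suc r)) \<le> (\<Sum>r<b. sqrt (2 / b) * doubling (b - Suc r))"
    using abs_hartley_le d by (intro sum_mono mult_right_mono) (auto intro: order_trans[OF abs_ge_self])
  also have "\<dots> = sqrt (2 / b) * 2 ^ (b - 1)" by (simp add: s flip: sum_distrib_left)
  finally have *: "(\<Sum>r<b. hartley b r (Suc i) * doubling (b - Suc r)) \<le> sqrt (2 / b) * 2 ^ (b - 1)" .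
  have "last_inverse_row i = (1 - \<eta>) * w i * (\<Sum>r<b. doubling (b - Suc r))
      - (\<Sum>r<b. hartley b r (Suc i) * doubling (b - Suc r))"
    using i by (simp add: last_inverse_row_def link_def algebra_simps sum.distrib sum_subtractf
        sum_negf sum_distrib_left)
  then show ?thesis using * unfolding s by (simp add: algebra_simps)
qed

lemma hartley_columns:
  assumes "k < a" "l < a"
  shows "(\<Sum>r<b. hartley b r (Suc k) * hartley b r (Suc l)) = (if k = l then 1 else 0)"
  using hartley_orthonormal[of "Suc k" b "Suc l"] assms b
  by (simp add: hartley_commute[of b _ "Suc k"] hartley_commute[of b _ "Suc l"])

lemma sum_hartley_column:
  assumes "k < a"
  shows "(\<Sum>r<b. hartley b r (Suc k)) = 0"
proof -
  have "(\<Sum>r<b. hartley b 0 r * hartley b (Suc k) r) = 0"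
    using hartley_orthonormal[of 0 b "Suc k"] assms b by simp
  then have "(\<Sum>r<b. hartley b r (Suc k)) / sqrt b = 0"
    by (simp add: hartley_commute[of b 0] hartley_0 hartley_commute[of b "Suc k"] sum_divide_distrib)
  then show ?thesis using b by simp
qed

text \<open>
  The columns in the span of the first \<open>a\<close> columns of \<open>L\<close> are unit vectors \<open>(x, G x)\<close>. As the two parts of
  \<open>G\<close> have orthogonal ranges, \<open>\<parallel>G x\<parallel>\<^sup>2 = b \<gamma>\<^sup>2 + \<parallel>x\<parallel>\<^sup>2\<close>, so \<open>\<parallel>x\<parallel>\<^sup>2 \<le> 1/2\<close>; and \<open>G x\<close> is a vector of norm at most
  \<open>1/\<surd>2\<close> plus a constant vector with entries of order \<open>1/\<surd>b\<close>.
\<close>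

lemma top_column_bounds:
  assumes y: "\<And>r. r < b \<Longrightarrow> y r = (\<Sum>k<a. link r k * x k)"
    and norm: "(\<Sum>k<a. (x k)\<^sup>2) + (\<Sum>r<b. (y r)\<^sup>2) = 1"
  shows "k < a \<Longrightarrow> (x k)\<^sup>2 \<le> 1 / 2" and "r < b \<Longrightarrow> \<bar>y r\<bar> \<le> sqrt (1 / 2) + sqrt (2 / b)"
proof -
  define \<gamma> where "\<gamma> = (1 - \<eta>) * (\<Sum>k<a. w k * x k)"
  define s where "s r = (\<Sum>k<a. hartley b r (Suc k) * x k)" for r
  have ys: "y r = s r - \<gamma>" if "r < b" for r
    using that by (simp add: y link_def s_def \<gamma>_def algebra_simps sum.distrib sum_subtractf
        sum_negf sum_distrib_left)
  have s2: "(\<Sum>r<b. (s r)\<^sup>2) = (\<Sum>k<a. (x k)\<^sup>2)"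
    unfolding s_def by (rule sum_squares_orthonormal_combination[OF hartley_columns])
  have s1: "(\<Sum>r<b. s r) = 0"
  proof -
    have "(\<Sum>r<b. s r) = (\<Sum>k<a. (\<Sum>r<b. hartley b r (Suc k)) * x k)"
      unfolding s_def sum_distrib_right by (rule sum.swap)
    then show ?thesis by (simp add: sum_hartley_column)
  qed
  have "(\<Sum>r<b. (y r)\<^sup>2) = (\<Sum>r<b. (s r)\<^sup>2 - 2 * \<gamma> * s r + \<gamma>\<^sup>2)"
    by (intro sum.cong) (auto simp: ys power2_diff)
  also have "\<dots> = (\<Sum>k<a. (x k)\<^sup>2) + real b * \<gamma>\<^sup>2"
    by (simp add: sum.distrib sum_subtractf s1 s2 flip: sum_distrib_left)
  finally have *: "2 * (\<Sum>k<a. (x k)\<^sup>2) + real b * \<gamma>\<^sup>2 = 1" using norm by simp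
  have "0 \<le> (\<Sum>k<a. (x k)\<^sup>2)" by (intro sum_nonneg) auto
  moreover have bg: "0 \<le> real b * \<gamma>\<^sup>2" by simp
  ultimately have \<gamma>b: "real b * \<gamma>\<^sup>2 \<le> 1" and x: "(\<Sum>k<a. (x k)\<^sup>2) \<le> 1 / 2"
    using * bg by linarith+
  show "(x k)\<^sup>2 \<le> 1 / 2" if "k < a"
    using member_le_sum[of k "{..<a}" "\<lambda>k. (x k)\<^sup>2"] that x by simp
  show "\<bar>y r\<bar> \<le> sqrt (1 / 2) + sqrt (2 / b)" if r: "r < b"
  proof -
    have "(s r)\<^sup>2 \<le> 1 / 2"
      using member_le_sum[of r "{..<b}" "\<lambda>r. (s r)\<^sup>2"] r x s2 by simp
    then have "\<bar>s r\<bar> \<le> sqrt (1 / 2)" using real_le_rsqrt by (metis power2_abs)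
    moreover have "\<gamma>\<^sup>2 \<le> 1 / b" using \<gamma>b b by (simp add: field_simps)
    then have "\<gamma>\<^sup>2 \<le> 2 / b" by (rule order_trans) (simp add: divide_right_mono)
    then have "\<bar>\<gamma>\<bar> \<le> sqrt (2 / b)" using real_le_rsqrt by (metis power2_abs)
    ultimately show ?thesis using ys[OF r] by linarith
  qed
qed

text \<open>
  The other columns are unit vectors \<open>(- G\<^sup>T y, y)\<close>. In the directions orthogonal to \<open>w\<close> on top, and to
  \<open>1\<close> and \<open>H w\<close> below, \<open>G\<^sup>T\<close> is an isometry, so both halves have norm at most \<open>1/\<surd>2\<close> there. The excluded
  directions below are flat, as is the one left over when \<open>b = a + 2\<close>; on top, a coordinate
  stays below \<open>\<surd>3/2\<close> if the unit vector along \<open>w\<close> is at most 1/2 there, since \<open>1/4 + 1/2 = 3/4\<close>.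
\<close>

lemma bottom_column_bounds:
  assumes x: "\<And>k. k < a \<Longrightarrow> x k = - (\<Sum>r<b. link r k * y r)"
    and norm: "(\<Sum>k<a. (x k)\<^sup>2) + (\<Sum>r<b. (y r)\<^sup>2) = 1"
    and ba: "b \<le> Suc (Suc a)" and sw: "(\<Sum>k<a. w k)\<^sup>2 \<le> 16 * (\<Sum>k<a. (w k)\<^sup>2)"
  shows "i < a \<Longrightarrow> 4 * (w i)\<^sup>2 \<le> (\<Sum>k<a. (w k)\<^sup>2) \<Longrightarrow> (x i)\<^sup>2 \<le> 3 / 4"
    and "r < b \<Longrightarrow> \<bar>y r\<bar> \<le> sqrt (1 / 2) + 6 * sqrt (2 / b)"
proof -
  define \<omega> where "\<omega> = (\<Sum>k<a. (w k)\<^sup>2)"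
  have "(w 0)\<^sup>2 \<le> \<omega>" unfolding \<omega>_def using a by (intro member_le_sum) auto
  moreover have "1\<^sup>2 \<le> (w 0)\<^sup>2" using w_pos[of 0] by (intro power_mono) auto
  ultimately have \<omega>: "0 < \<omega>" by simp
  define \<gamma> where "\<gamma> = (1 - \<eta>) * (\<Sum>r<b. y r)"
  define h where "h k = (\<Sum>r<b. hartley b k r * y r)" for k
  define z where "z k = h (Suc k)" for k
  have xz: "x k = \<gamma> * w k - z k" if "k < a" for k
    using that by (simp add: x link_def z_def h_def \<gamma>_def hartley_commute[of b "Suc k"] algebra_simps
        sum.distrib sum_subtractf sum_negf sum_distrib_left sum_distrib_right)
  define t where "t = (\<Sum>k<a. x k * w k) / \<omega>"
  define \<zeta> where "\<zeta> = (\<Sum>k<a. z k * w k) / \<omega>"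
  \<comment> \<open>The components orthogonal to \<open>w\<close> of \<open>x\<close> and of \<open>z = H\<^sup>T y\<close> agree up to sign, since \<open>x + z\<close> is a multiple of \<open>w\<close>.\<close>
  define q where "q k = x k - t * w k" for k
  have "(\<Sum>k<a. x k * w k) = \<gamma> * \<omega> - (\<Sum>k<a. z k * w k)"
    by (simp add: xz \<omega>_def power2_eq_square algebra_simps sum_subtractf sum_distrib_left)
  then have \<gamma>t: "\<gamma> = t + \<zeta>" using \<omega> by (simp add: t_def \<zeta>_def diff_divide_distrib)
  then have zq: "z k = \<zeta> * w k - q k" if "k < a" for k
    using xz[OF that] unfolding q_def \<gamma>t distrib_right by linarith
  have x2: "(\<Sum>k<a. (x k)\<^sup>2) = t\<^sup>2 * \<omega> + (\<Sum>k<a. (q k)\<^sup>2)"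
    using orthogonal_decomposition[of w a x] \<omega> by (simp add: t_def q_def \<omega>_def)
  have "(\<Sum>k<a. (z k)\<^sup>2) = \<zeta>\<^sup>2 * \<omega> + (\<Sum>k<a. (z k - \<zeta> * w k)\<^sup>2)"
    using orthogonal_decomposition[of w a z] \<omega> by (simp add: \<zeta>_def \<omega>_def)
  also have "(\<Sum>k<a. (z k - \<zeta> * w k)\<^sup>2) = (\<Sum>k<a. (q k)\<^sup>2)"
    by (intro sum.cong) (auto simp: zq)
  finally have z2: "(\<Sum>k<a. (z k)\<^sup>2) = \<zeta>\<^sup>2 * \<omega> + (\<Sum>k<a. (q k)\<^sup>2)" .
  have h2: "(\<Sum>k<b. (h k)\<^sup>2) = (\<Sum>r<b. (y r)\<^sup>2)"
    unfolding h_def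
  proof (rule sum_squares_orthonormal_combination)
    show "(\<Sum>r<b. hartley b r k * hartley b r l) = (if k = l then 1 else 0)" if "k < b" "l < b" for k l
      using hartley_orthonormal[OF that]
      by (simp add: hartley_commute[of b k] hartley_commute[of b l])
  qed
  have "(\<Sum>k<a. (z k)\<^sup>2) = (\<Sum>k\<in>Suc ` {..<a}. (h k)\<^sup>2)"
    by (simp add: sum.reindex z_def)
  also have "\<dots> \<le> (\<Sum>k<b. (h k)\<^sup>2)" using b by (intro sum_mono2) auto
  finally have zy: "(\<Sum>k<a. (z k)\<^sup>2) \<le> (\<Sum>r<b. (y r)\<^sup>2)" unfolding h2 .
  have q0: "0 \<le> (\<Sum>k<a. (q k)\<^sup>2)" by (intro sum_nonneg) auto
  have nn: "0 \<le> t\<^sup>2 * \<omega>" "0 \<le> \<zeta>\<^sup>2 * \<omega>" using \<omega> by auto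
  have tq: "t\<^sup>2 * \<omega> + 2 * (\<Sum>k<a. (q k)\<^sup>2) \<le> 1" using norm x2 z2 zy nn by linarith
  have x0: "0 \<le> (\<Sum>k<a. (x k)\<^sup>2)" by (intro sum_nonneg) auto
  show "(x i)\<^sup>2 \<le> 3 / 4" if i: "i < a" and wi: "4 * (w i)\<^sup>2 \<le> (\<Sum>k<a. (w k)\<^sup>2)"
  proof -
    have qi: "(q i)\<^sup>2 \<le> (\<Sum>k<a. (q k)\<^sup>2)"
      using i by (intro member_le_sum) auto
    have "x i = t * sqrt \<omega> * (w i / sqrt \<omega>) + sqrt 2 * q i * sqrt (1 / 2)"
      using \<omega> by (simp add: q_def real_sqrt_divide)
    also have "(\<dots>)\<^sup>2 \<le> ((t * sqrt \<omega>)\<^sup>2 + (sqrt 2 * q i)\<^sup>2) * ((w i / sqrt \<omega>)\<^sup>2 + (sqrt (1 / 2))\<^sup>2)"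
      by (rule cauchy_schwarz_2)
    also have "\<dots> = (t\<^sup>2 * \<omega> + 2 * (q i)\<^sup>2) * ((w i)\<^sup>2 / \<omega> + 1 / 2)"
      using \<omega> by (simp add: power_mult_distrib power_divide)
    also have "\<dots> \<le> 1 * (1 / 4 + 1 / 2)"
    proof (intro mult_mono)
      show "t\<^sup>2 * \<omega> + 2 * (q i)\<^sup>2 \<le> 1" using tq qi by linarith
      show "(w i)\<^sup>2 / \<omega> + 1 / 2 \<le> 1 / 4 + 1 / 2"
        using wi \<omega> unfolding \<omega>_def[symmetric] by (simp add: field_simps)
    qed (use \<omega> in auto)
    finally show ?thesis by simp
  qed
  show "\<bar>y r\<bar> \<le> sqrt (1 / 2) + 6 * sqrt (2 / b)" if r: "r < b"
  proof -
    \<comment> \<open>The Hartley coordinates \<open>h\<close> of \<open>y\<close> are \<open>h 0\<close>, the \<open>a\<close> entries of \<open>z\<close>, and at most one more.\<close>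
    define E where "E = (if b = Suc a then 0 else hartley b r (Suc a) * h (Suc a))"
    have hle: "\<bar>hartley b r k * h k\<bar> \<le> sqrt (2 / b)" if "k < b" for k
    proof -
      have "(h k)\<^sup>2 \<le> (\<Sum>k<b. (h k)\<^sup>2)" using that by (intro member_le_sum) auto
      also have "\<dots> \<le> 1" using h2 norm x0 by linarith
      finally have "\<bar>h k\<bar> \<le> 1" by (simp add: abs_square_le_1)
      then have "\<bar>hartley b r k\<bar> * \<bar>h k\<bar> \<le> sqrt (2 / b) * 1"
        by (intro mult_mono abs_hartley_le) auto
      then show ?thesis by (simp add: abs_mult)
    qed
    have E: "\<bar>E\<bar> \<le> sqrt (2 / b)"
      using hle[of "Suc a"] ba b by (auto simp: E_def)
    have "(\<Sum>k<b. hartley b r k * h k) = (\<Sum>k<b. \<Sum>s<b. hartley b r k * hartley b s k * y s)"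
      unfolding h_def sum_distrib_left
      by (intro sum.cong refl) (subst hartley_commute, simp)
    also have "\<dots> = (\<Sum>s<b. \<Sum>k<b. hartley b r k * hartley b s k * y s)"
      by (rule sum.swap)
    also have "\<dots> = (\<Sum>s<b. (\<Sum>k<b. hartley b r k * hartley b s k) * y s)"
      by (simp add: sum_distrib_right)
    also have "\<dots> = (\<Sum>s<b. if s = r then y r else 0)"
      using r by (intro sum.cong) (auto simp: hartley_orthonormal)
    also have "\<dots> = y r" using r by simp
    finally have "y r = (\<Sum>k<b. hartley b r k * h k)" by simp
    also have "\<dots> = hartley b r 0 * h 0 + (\<Sum>k<a. hartley b r (Suc k) * z k) + E"
    proof (cases "b = Suc a")
      case True
      then show ?thesis
        unfolding z_def E_def by (simp add: sum.lessThan_Suc_shift del: sum.lessThan_Suc)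
    next
      case False
      then have "b = Suc (Suc a)" using ba b by simp
      then show ?thesis
        unfolding z_def E_def using sum.lessThan_Suc_shift[of "\<lambda>k. hartley b r k * h k" a] by simp
    qed
    also have "(\<Sum>k<a. hartley b r (Suc k) * z k)
        = \<zeta> * (\<Sum>k<a. hartley b r (Suc k) * w k) - (\<Sum>k<a. hartley b r (Suc k) * q k)"
      by (simp add: zq algebra_simps sum_subtractf sum_distrib_left)
    finally have y: "y r = hartley b r 0 * h 0 + (\<zeta> * (\<Sum>k<a. hartley b r (Suc k) * w k)
        - (\<Sum>k<a. hartley b r (Suc k) * q k)) + E" .
    have "(\<Sum>k<a. hartley b r (Suc k) * q k)\<^sup>2
        \<le> (\<Sum>k<a. (hartley b r (Suc k))\<^sup>2) * (\<Sum>k<a. (q k)\<^sup>2)"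
      by (rule cauchy_schwarz_sum)
    also have "\<dots> \<le> 1 * (1 / 2)"
    proof (intro mult_mono)
      have "(\<Sum>k<a. (hartley b r (Suc k))\<^sup>2) = (\<Sum>k\<in>Suc ` {..<a}. (hartley b r k)\<^sup>2)"
        by (simp add: sum.reindex)
      also have "\<dots> \<le> (\<Sum>k<b. (hartley b r k)\<^sup>2)" using b by (intro sum_mono2) auto
      also have "\<dots> = 1" using hartley_orthonormal[OF r r] by (simp add: power2_eq_square)
      finally show "(\<Sum>k<a. (hartley b r (Suc k))\<^sup>2) \<le> 1" .
      show "(\<Sum>k<a. (q k)\<^sup>2) \<le> 1 / 2" using tq nn by linarith
    qed (use q0 in auto)
    finally have Hq: "\<bar>\<Sum>k<a. hartley b r (Suc k) * q k\<bar> \<le> sqrt (1 / 2)"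
      using real_le_rsqrt by (metis power2_abs mult_1)
    have "\<bar>\<zeta> * (\<Sum>k<a. hartley b r (Suc k) * w k)\<bar> \<le> \<bar>\<zeta>\<bar> * (\<Sum>k<a. sqrt (2 / b) * w k)"
      unfolding abs_mult
    proof (intro mult_left_mono)
      show "\<bar>\<Sum>k<a. hartley b r (Suc k) * w k\<bar> \<le> (\<Sum>k<a. sqrt (2 / b) * w k)"
      proof (rule order_trans[OF sum_abs], rule sum_mono)
        fix k
        have "\<bar>hartley b r (Suc k)\<bar> * \<bar>w k\<bar> \<le> sqrt (2 / b) * \<bar>w k\<bar>"
          by (intro mult_right_mono abs_hartley_le) auto
        then show "\<bar>hartley b r (Suc k) * w k\<bar> \<le> sqrt (2 / b) * w k"
          using w_pos[of k] by (simp add: abs_mult)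
      qed
    qed auto
    also have "\<dots> = (\<bar>\<zeta>\<bar> * (\<Sum>k<a. w k)) * sqrt (2 / b)" by (simp flip: sum_distrib_left)
    also have "\<dots> \<le> 4 * sqrt (2 / b)"
    proof (intro mult_right_mono)
      have "(\<bar>\<zeta>\<bar> * (\<Sum>k<a. w k))\<^sup>2 \<le> \<zeta>\<^sup>2 * (16 * \<omega>)"
        unfolding power_mult_distrib power2_abs \<omega>_def using sw by (intro mult_left_mono) auto
      also have "\<dots> \<le> 4\<^sup>2" using z2 zy norm q0 x0 by simp
      finally show "\<bar>\<zeta>\<bar> * (\<Sum>k<a. w k) \<le> 4" by (rule power2_le_imp_le) simp
    qed simp
    finally have "\<bar>\<zeta> * (\<Sum>k<a. hartley b r (Suc k) * w k)\<bar> \<le> 4 * sqrt (2 / b)" .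
    then show ?thesis using y Hq E hle[of 0] r by linarith
  qed
qed

end

lemma four_power: "(4::real) ^ n = (2 ^ n)\<^sup>2"
  by (simp add: power2_eq_square flip: power_mult_distrib)

text \<open>
  Bessel's inequality for a row, restricted to two columns.
\<close>

lemma orthonormal_columns_row_bound:
  assumes pf: "pivoted_factors n L U" and "i < n" "j < n" "j' < n" "j \<noteq> j'"
  shows "(stage L U 0 i j)\<^sup>2 + (stage L U 0 i j')\<^sup>2 \<le> 1"
proof -
  define c where "c = stage L U 0 i j"
  define d where "d = stage L U 0 i j'"
  define N where "N = c\<^sup>2 + d\<^sup>2"
  have "(\<Sum>i<n. (c * stage L U 0 i j + d * stage L U 0 i j')\<^sup>2)
      = c\<^sup>2 * (\<Sum>i<n. stage L U 0 i j * stage L U 0 i j)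
        + d\<^sup>2 * (\<Sum>i<n. stage L U 0 i j' * stage L U 0 i j')
        + 2 * c * d * (\<Sum>i<n. stage L U 0 i j * stage L U 0 i j')"
    by (simp add: power2_eq_square algebra_simps sum.distrib sum_distrib_left)
  also have "\<dots> = N" using pivoted_factorsD(4)[OF pf] assms(3-5) by (simp add: N_def)
  finally have "(\<Sum>i<n. (c * stage L U 0 i j + d * stage L U 0 i j')\<^sup>2) = N" .
  moreover have "(c * stage L U 0 i j + d * stage L U 0 i j')\<^sup>2
      \<le> (\<Sum>i<n. (c * stage L U 0 i j + d * stage L U 0 i j')\<^sup>2)"
    using assms(2) by (intro member_le_sum) auto
  ultimately have "N * N \<le> N * 1"
    by (simp add: N_def c_def d_def power2_eq_square)
  moreover have "0 \<le> N" by (simp add: N_def)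
  ultimately have "N \<le> 1" by (cases "N = 0") (auto simp: mult_le_cancel_left)
  then show ?thesis by (simp add: N_def c_def d_def)
qed

context two_block
begin

lemma top_columns_link:
  assumes pf: "pivoted_factors (a + b) left_factor U" and j: "j < a" and r: "r < b"
  shows "stage left_factor U 0 (a + r) j = (\<Sum>k<a. link r k * stage left_factor U 0 k j)"
proof -
  have band_block: "stage left_factor U 0 k j = (\<Sum>l<a. band_block k l * U l j)" if k: "k < a" for k
  proof -
    have "stage left_factor U 0 k j = (\<Sum>l\<in>{0..k}. band_block k l * U l j)"
      using k by (simp add: stage_def left_factor_def)
    also have "\<dots> = (\<Sum>l<a. band_block k l * U l j)"
      using k by (intro sum.mono_neutral_left) (auto simp: band_block_def)
    finally show ?thesis .
  qed
  have "stage left_factor U 0 (a + r) j = (\<Sum>l<a. left_factor (a + r) l * U l j)"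
    unfolding stage_def using pivoted_factorsD(3)[OF pf] j r
    by (intro sum.mono_neutral_right) auto
  also have "\<dots> = (\<Sum>l<a. \<Sum>k<a. link r k * (band_block k l * U l j))"
    by (simp add: left_factor_def sum_distrib_right mult.assoc)
  also have "\<dots> = (\<Sum>k<a. \<Sum>l<a. link r k * (band_block k l * U l j))"
    by (rule sum.swap)
  also have "\<dots> = (\<Sum>k<a. link r k * stage left_factor U 0 k j)"
    by (simp add: band_block sum_distrib_left)
  finally show ?thesis .
qed

lemma bottom_columns_link:
  assumes pf: "pivoted_factors (a + b) left_factor U" and j: "a \<le> j" "j < a + b" and k: "k < a"
  shows "stage left_factor U 0 k j = - (\<Sum>r<b. link r k * stage left_factor U 0 (a + r) j)"
proof -
  define z where "z k = stage left_factor U 0 k j + (\<Sum>r<b. link r k * stage left_factor U 0 (a + r) j)" for k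
  have "(\<Sum>k<a. z k * band_block k m) = 0" if "m < a" for m
    using column_perp[OF pf, of m j] sum_left_factor_column[OF that, of "\<lambda>i. stage left_factor U 0 i j"]
      that j by (simp add: z_def)
  then have "z k = 0" using band_block_injective k by blast
  then show ?thesis by (simp add: z_def)
qed

lemma w_le: "i < a \<Longrightarrow> w i \<le> 2 ^ (a - Suc i)"
  unfolding w_def by (rule band_weight_le)

lemma w_ge:
  assumes "real a / 2 ^ Suc K \<le> \<epsilon>" "i < a"
  shows "(1 - \<epsilon>) * 2 ^ (a - Suc i) \<le> w i"
proof -
  have "real (a - Suc i) / 2 ^ Suc K \<le> real a / 2 ^ Suc K"
    by (intro divide_right_mono) auto
  then have "(1 - \<epsilon>) * 2 ^ (a - Suc i) \<le> (1 - real (a - Suc i) / 2 ^ Suc K) * 2 ^ (a - Suc i)"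
    using assms(1) by (intro mult_right_mono) auto
  also have "\<dots> \<le> w i" unfolding w_def by (rule band_weight_lower[OF K])
  finally show ?thesis .
qed

lemma sum_powers_down: "(\<Sum>i<a. c ^ (a - Suc i)) = (\<Sum>k<a. c ^ k)" for c :: real
  by (rule sum.nat_diff_reindex)

text \<open>
  The last row of \<open>L\<inverse>\<close> is nearly \<open>2\<^bsup>a + b - 2\<^esup>, 2\<^bsup>a + b - 3\<^esup>, \<dots>\<close> in its upper part, which carries almost
  all of its norm.
\<close>

lemma last_inverse_row_ge:
  assumes \<eta>\<epsilon>: "\<eta> \<le> \<epsilon>" and \<epsilon>: "\<epsilon> \<le> 1 / 40" and band: "real a / 2 ^ Suc K \<le> \<epsilon>" and i: "i < a"
  shows "(1 - 3 * \<epsilon>) * (2 ^ (b - 1) * 2 ^ (a - Suc i)) \<le> last_inverse_row i"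
proof -
  define P :: real where "P = 2 ^ (a - Suc i)"
  have P: "1 \<le> P" by (simp add: P_def)
  have \<epsilon>0: "0 \<le> \<epsilon>" using \<eta> \<eta>\<epsilon> by linarith
  have "(1 - \<epsilon>) * ((1 - \<epsilon>) * P) \<le> (1 - \<eta>) * w i"
    using w_ge[OF band i] \<eta>\<epsilon> \<epsilon> P \<eta> w_pos[of i] unfolding P_def[symmetric]
    by (intro mult_mono) auto
  moreover have "sqrt (2 / b) \<le> \<epsilon> * P"
    using \<eta>(3) \<eta>\<epsilon> mult_left_mono[OF P \<epsilon>0] by simp
  moreover have "(1 - \<epsilon>) * ((1 - \<epsilon>) * P) - \<epsilon> * P = (1 - 3 * \<epsilon>) * P + \<epsilon>\<^sup>2 * P"
    by (simp add: power2_eq_square algebra_simps)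
  moreover have "0 \<le> \<epsilon>\<^sup>2 * P" using P by simp
  ultimately have "(1 - 3 * \<epsilon>) * P \<le> (1 - \<eta>) * w i - sqrt (2 / b)" by linarith
  then have "2 ^ (b - 1) * ((1 - 3 * \<epsilon>) * P) \<le> 2 ^ (b - 1) * ((1 - \<eta>) * w i - sqrt (2 / b))"
    by (intro mult_left_mono) auto
  also have "\<dots> \<le> last_inverse_row i" by (rule last_inverse_row_lower[OF i])
  finally show ?thesis by (simp add: P_def mult_ac)
qed

lemma last_inverse_row_norm_ge:
  assumes \<eta>\<epsilon>: "\<eta> \<le> \<epsilon>" and \<epsilon>: "\<epsilon> \<le> 1 / 40" and band: "real a / 2 ^ Suc K \<le> \<epsilon>"
    and tail: "1 / 4 ^ a \<le> \<epsilon>"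
  shows "((1 - 4 * \<epsilon>) * 2 ^ (a + b - 1))\<^sup>2 / 3 \<le> (\<Sum>i<a + b. (last_inverse_row i)\<^sup>2)"
proof -
  have \<epsilon>0: "0 \<le> \<epsilon>" using \<eta> \<eta>\<epsilon> by linarith
  have "(\<Sum>i<a. ((1 - 3 * \<epsilon>) * (2 ^ (b - 1) * 2 ^ (a - Suc i)))\<^sup>2) \<le> (\<Sum>i<a. (last_inverse_row i)\<^sup>2)"
    using last_inverse_row_ge[OF \<eta>\<epsilon> \<epsilon> band] \<epsilon> by (intro sum_mono power_mono) auto
  also have "\<dots> \<le> (\<Sum>i<a + b. (last_inverse_row i)\<^sup>2)" by (intro sum_mono2) auto
  also have "(\<Sum>i<a. ((1 - 3 * \<epsilon>) * (2 ^ (b - 1) * 2 ^ (a - Suc i)))\<^sup>2)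
      = ((1 - 3 * \<epsilon>) * 2 ^ (b - 1))\<^sup>2 * (\<Sum>i<a. 4 ^ (a - Suc i))"
    by (simp add: sum_distrib_left power_mult_distrib power_even_eq mult.assoc
        flip: power_mult[of 2 _ 2] power_mult[of 2 2])
       (simp add: power_mult mult.commute[of _ 2])
  also have "(\<Sum>i<a. 4 ^ (a - Suc i)) = (4 ^ a - 1) / (3::real)"
    unfolding sum_powers_down by (simp add: geometric_sum)
  finally have *: "((1 - 3 * \<epsilon>) * 2 ^ (b - 1))\<^sup>2 * ((4 ^ a - 1) / 3) \<le> (\<Sum>i<a + b. (last_inverse_row i)\<^sup>2)" .
  have "(1 - 4 * \<epsilon>)\<^sup>2 * 4 ^ a \<le> (1 - 3 * \<epsilon>)\<^sup>2 * (4 ^ a - 1)"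
  proof -
    have "1 - 4 * \<epsilon> \<le> (1 - 3 * \<epsilon>) * (1 - \<epsilon>)" using \<epsilon>0 by (simp add: algebra_simps)
    then have "(1 - 4 * \<epsilon>)\<^sup>2 \<le> ((1 - 3 * \<epsilon>) * (1 - \<epsilon>))\<^sup>2" using \<epsilon> by (intro power_mono) auto
    also have "\<dots> = (1 - 3 * \<epsilon>)\<^sup>2 * ((1 - \<epsilon>) * (1 - \<epsilon>))"
      by (simp add: power_mult_distrib power2_eq_square)
    also have "\<dots> \<le> (1 - 3 * \<epsilon>)\<^sup>2 * ((1 - \<epsilon>) * 1)"
      using \<epsilon>0 \<epsilon> by (intro mult_left_mono) auto
    finally have "(1 - 4 * \<epsilon>)\<^sup>2 * 4 ^ a \<le> (1 - 3 * \<epsilon>)\<^sup>2 * ((1 - \<epsilon>) * 4 ^ a)" 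
      by (simp add: mult.assoc[symmetric] mult_right_mono)
    also have "(1 - \<epsilon>) * 4 ^ a \<le> (4 ^ a - 1 :: real)" using tail by (simp add: field_simps)
    then have "(1 - 3 * \<epsilon>)\<^sup>2 * ((1 - \<epsilon>) * 4 ^ a) \<le> (1 - 3 * \<epsilon>)\<^sup>2 * (4 ^ a - 1)"
      by (intro mult_left_mono) auto
    finally show ?thesis .
  qed
  then have ineq: "(2 ^ (b - 1))\<^sup>2 / 3 * ((1 - 4 * \<epsilon>)\<^sup>2 * 4 ^ a)
      \<le> (2 ^ (b - 1))\<^sup>2 / 3 * ((1 - 3 * \<epsilon>)\<^sup>2 * (4 ^ a - 1))"
    by (intro mult_left_mono) auto
  have "(2::real) ^ (a + b - 1) = 2 ^ (b - 1) * 2 ^ a" using b by (simp flip: power_add)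
  then have "((1 - 4 * \<epsilon>) * 2 ^ (a + b - 1))\<^sup>2 / 3 = (2 ^ (b - 1))\<^sup>2 / 3 * ((1 - 4 * \<epsilon>)\<^sup>2 * 4 ^ a)"
    by (simp add: four_power power_mult_distrib mult_ac)
  moreover have "((1 - 3 * \<epsilon>) * 2 ^ (b - 1))\<^sup>2 * ((4 ^ a - 1) / 3)
      = (2 ^ (b - 1))\<^sup>2 / 3 * ((1 - 3 * \<epsilon>)\<^sup>2 * (4 ^ a - 1))"
    by (simp add: power_mult_distrib mult_ac)
  ultimately show ?thesis using * ineq by linarith
qed

text \<open>
  \<open>w\<close> is close to \<open>2\<^bsup>a - 1\<^esup>, \<dots>, 2, 1\<close>, whose norm is about \<open>1/\<surd>3\<close> times its sum and whose first entry dominates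
  the others.
\<close>

lemma weights_spread:
  assumes "\<epsilon> \<le> 1 / 40" and band: "real a / 2 ^ Suc K \<le> \<epsilon>"
  shows "(\<Sum>k<a. w k)\<^sup>2 \<le> 16 * (\<Sum>k<a. (w k)\<^sup>2)"
    and "0 < i \<Longrightarrow> i < a \<Longrightarrow> 4 * (w i)\<^sup>2 \<le> (\<Sum>k<a. (w k)\<^sup>2)"
proof -
  define a' where "a' = a - 2"
  have a': "a = Suc (Suc a')" using a by (simp add: a'_def)
  define P :: real where "P = 2 ^ a'"
  have P: "0 < P" by (simp add: P_def)
  have P2: "(39 / 20 * P)\<^sup>2 = 1521 / 400 * P\<^sup>2" by (simp add: power2_eq_square)
  have "(39 / 40) * (2 * P) \<le> (1 - \<epsilon>) * (2 * P)" using P assms(1) by (intro mult_right_mono) auto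
  also have "\<dots> \<le> w 0" using w_ge[OF band, of 0] a by (simp add: a' P_def)
  finally have w0: "(39 / 20 * P)\<^sup>2 \<le> (w 0)\<^sup>2" using P by (intro power_mono) auto
  have "(w 0)\<^sup>2 \<le> (\<Sum>k<a. (w k)\<^sup>2)" using a by (intro member_le_sum) auto
  then have \<omega>: "(39 / 20 * P)\<^sup>2 \<le> (\<Sum>k<a. (w k)\<^sup>2)" using w0 by linarith
  have "(\<Sum>k<a. w k) \<le> (\<Sum>k<a. 2 ^ (a - Suc k))" using w_le by (intro sum_mono) auto
  also have "\<dots> \<le> 4 * P" unfolding sum_powers_down by (simp add: geometric_sum a' P_def)
  finally have "(\<Sum>k<a. w k)\<^sup>2 \<le> (4 * P)\<^sup>2"
    using w_pos by (intro power_mono sum_nonneg) (auto intro: order_trans[OF zero_le_one])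
  also have "\<dots> \<le> 16 * (39 / 20 * P)\<^sup>2" unfolding P2 by (simp add: power_mult_distrib)
  also have "\<dots> \<le> 16 * (\<Sum>k<a. (w k)\<^sup>2)" using \<omega> by simp
  finally show "(\<Sum>k<a. w k)\<^sup>2 \<le> 16 * (\<Sum>k<a. (w k)\<^sup>2)" .
  show "4 * (w i)\<^sup>2 \<le> (\<Sum>k<a. (w k)\<^sup>2)" if i: "0 < i" "i < a"
  proof -
    have "w i \<le> 2 ^ (a - Suc i)" by (rule w_le[OF i(2)])
    also have "\<dots> \<le> P" unfolding P_def using i by (intro power_increasing) (auto simp: a')
    finally have "(w i)\<^sup>2 \<le> P\<^sup>2" using w_pos[of i] by (intro power_mono) auto
    then have "3 * (w i)\<^sup>2 \<le> (39 / 20 * P)\<^sup>2" unfolding P2 using zero_le_power2[of P] by linarith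
    then have "4 * (w i)\<^sup>2 \<le> (w 0)\<^sup>2 + (w i)\<^sup>2" using w0 by linarith
    also have "\<dots> = (\<Sum>k\<in>{0, i}. (w k)\<^sup>2)" using i by simp
    also have "\<dots> \<le> (\<Sum>k<a. (w k)\<^sup>2)" using i by (intro sum_mono2) auto
    finally show ?thesis .
  qed
qed

text \<open>
  The last pivot is about \<open>2\<^bsup>n - 1\<^esup> / \<surd>3\<close>, with \<open>n = a + b\<close>. The last column of \<open>Q\<close> is the last row of \<open>L\<inverse>\<close>
  divided by that norm, with entries at most about \<open>\<surd>3/2\<close>; in the other columns the modulus never
  exceeds \<open>\<surd>3/2\<close>. The quotient is \<open>2/3\<close> of \<open>2\<^bsup>n - 1\<^esup>\<close>.
\<close>

lemma near_extremal_growth: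
  assumes ba: "b \<le> Suc (Suc a)" and \<eta>\<epsilon>: "\<eta> \<le> \<epsilon>" and \<epsilon>: "\<epsilon> \<le> 1 / 40"
    and band: "real a / 2 ^ Suc K \<le> \<epsilon>" and tail: "1 / 4 ^ a \<le> \<epsilon>"
  shows "\<exists>L U. pivoted_factors (a + b) L U \<and>
    (1 - 4 * \<epsilon>)\<^sup>2 * (2 / 3 * 2 ^ (a + b - 1)) \<le> lu_growth (a + b) L U"
proof -
  obtain n where n: "a + b = Suc n" "1 \<le> n" "a \<le> n" using a b by (cases "a + b") auto
  obtain U where pf: "pivoted_factors (a + b) left_factor U"
    using orthogonal_factor_exists[of "a + b" left_factor] left_factor_bounds(1,2) by blast
  note pf' = pf[unfolded n(1)]
  define Q where "Q = stage left_factor U 0"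
  define u where "u = U n n"
  have \<epsilon>0: "0 \<le> \<epsilon>" using \<eta> \<eta>\<epsilon> by linarith
  have null: "last_inverse_row i = u * Q i n" if "i \<le> n" for i
    using that unfolding u_def Q_def
  proof (rule left_inverse_unique[where L = left_factor, rotated 3])
    show "last_inverse_row n = U n n * stage left_factor U 0 n n"
      using last_column_left_inverse(1)[OF pf'] n by (simp add: last_inverse_row_def doubling_def)
    show "last_inverse_row m = - (\<Sum>i\<in>{m<..n}. last_inverse_row i * left_factor i m)" if "m < n" for m
    proof -
      have "{m<..n} = {m<..<a + b}" using n by auto
      then show ?thesis using last_inverse_row_recursion[of m] that n by simp
    qed
    show "U n n * stage left_factor U 0 m n
        = - (\<Sum>i\<in>{m<..n}. U n n * stage left_factor U 0 i n * left_factor i m)" if "m < n" for m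
      using last_column_left_inverse(2)[OF pf' that] .
  qed
  have "(\<Sum>i<a + b. (last_inverse_row i)\<^sup>2) = (\<Sum>i\<le>n. (u * Q i n)\<^sup>2)"
    unfolding n(1) lessThan_Suc_atMost by (intro sum.cong) (auto simp: null)
  also have "\<dots> = u\<^sup>2"
    using last_column_left_inverse(3)[OF pf'] unfolding u_def Q_def .
  finally have norm: "(\<Sum>i<a + b. (last_inverse_row i)\<^sup>2) = u\<^sup>2" .
  have u2: "((1 - 4 * \<epsilon>) * 2 ^ n)\<^sup>2 / 3 \<le> u\<^sup>2"
    using last_inverse_row_norm_ge[OF \<eta>\<epsilon> \<epsilon> band tail] norm n(1) by simp
  have "((1 - 4 * \<epsilon>) * 2 ^ n / sqrt 3)\<^sup>2 \<le> \<bar>u\<bar>\<^sup>2" using u2 by (simp add: power_divide)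
  then have u: "(1 - 4 * \<epsilon>) * 2 ^ n / sqrt 3 \<le> \<bar>u\<bar>" by (rule power2_le_imp_le) simp
  have "0 < (1 - 4 * \<epsilon>) * 2 ^ n / sqrt 3" using \<epsilon> by simp
  then have u0: "0 < \<bar>u\<bar>" using u by linarith
  define d where "d k = \<bar>u * Q (n - k) n\<bar>" for k
  note dom = last_column_dominated[OF pf', folded u_def, folded Q_def, folded d_def]
  have d0: "0 \<le> d k" for k by (simp add: d_def)
  have ds: "(\<Sum>i<Suc k. d i) \<le> 2 ^ k" if "k \<le> n" for k
    using that dom(1,2) by (intro dominated_sum_le[of d "Suc n"]) auto
  have last: "\<bar>u * Q i n\<bar> \<le> 2 ^ (n - 1)" if i: "i \<le> n" for i
  proof (cases "i = n")
    case True
    then show ?thesis using dom(1) by (simp add: d_def)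
  next
    case False
    define k where "k = n - Suc i"
    have k: "n - i = Suc k" "Suc k \<le> n" using False i by (auto simp: k_def)
    have "\<bar>u * Q i n\<bar> = d (n - i)" using i by (simp add: d_def)
    also have "\<dots> \<le> (\<Sum>j<Suc k. d j)" unfolding k(1) using k by (intro dom(2)) auto
    also have "\<dots> \<le> 2 ^ k" using ds[of k] k by simp
    also have "\<dots> \<le> 2 ^ (n - 1)" using k by (intro power_increasing) auto
    finally show ?thesis .
  qed
  have u_le: "u\<^sup>2 \<le> 4 ^ n / 2"
  proof -
    have "3 * (\<Sum>i<Suc n. (d i)\<^sup>2) \<le> (\<Sum>i<Suc n. d i)\<^sup>2 + 2"
      using dom(1,2) d0 by (intro dominated_sum_squares_le[of d "Suc n"]) auto
    also have "(\<Sum>i<Suc n. d i)\<^sup>2 \<le> (2 ^ n)\<^sup>2"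
      using ds[of n] d0 by (intro power_mono sum_nonneg) auto
    also have "(2 ^ n)\<^sup>2 = (4::real) ^ n" by (simp add: four_power)
    finally have "3 * u\<^sup>2 \<le> 4 ^ n + 2" using dom(3) by (simp add: lessThan_Suc_atMost)
    moreover have "(4::real) ^ 1 \<le> 4 ^ n" using n by (intro power_increasing) auto
    ultimately show ?thesis by simp
  qed
  \<comment> \<open>The top right entry is close to \<open>\<surd>3/2\<close>, which leaves little room for the rest of the first row.\<close>
  have corner: "1 / 4 \<le> (Q 0 n)\<^sup>2"
  proof -
    have "(2::real) ^ (b - 1) * 2 ^ (a - Suc 0) = 2 ^ (n - 1)"
    proof -
      have "b - 1 + (a - Suc 0) = n - 1" using n(1) a b by arith
      then show ?thesis by (simp flip: power_add)
    qed
    then have "(1 - 3 * \<epsilon>) * 2 ^ (n - 1) \<le> u * Q 0 n"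
      using last_inverse_row_ge[OF \<eta>\<epsilon> \<epsilon> band, of 0] a null[of 0] by simp
    then have "((1 - 3 * \<epsilon>) * 2 ^ (n - 1))\<^sup>2 \<le> (u * Q 0 n)\<^sup>2"
      using \<epsilon> by (intro power_mono) auto
    moreover have "(3 / 4 * 2 ^ (n - 1))\<^sup>2 \<le> ((1 - 3 * \<epsilon>) * 2 ^ (n - 1))\<^sup>2"
      using \<epsilon> by (intro power_mono mult_right_mono) auto
    moreover have "(3 / 4 * 2 ^ (n - 1))\<^sup>2 = (9 / 64 * 4 ^ n :: real)"
    proof -
      obtain m where "n = Suc m" using n by (cases n) auto
      moreover have "(2 ^ m)\<^sup>2 = (4::real) ^ m" by (simp add: four_power)
      ultimately show ?thesis by (simp add: power_mult_distrib power_divide)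
    qed
    moreover have "(u * Q 0 n)\<^sup>2 \<le> 4 ^ n / 2 * (Q 0 n)\<^sup>2"
      unfolding power_mult_distrib using u_le by (intro mult_right_mono) auto
    ultimately have "4 ^ n * (9 / 32) \<le> 4 ^ n * (Q 0 n)\<^sup>2" by linarith
    then have "9 / 32 \<le> (Q 0 n)\<^sup>2" by (subst (asm) mult_le_cancel_left_pos) auto
    then show ?thesis by simp
  qed
  have s: "sqrt (1 / 2) + 6 * sqrt (2 / b) \<le> sqrt (3 / 4)"
  proof -
    have "sqrt (1 / 2) \<le> 71 / 100" by (rule real_le_lsqrt) (auto simp: power2_eq_square)
    moreover have "86 / 100 \<le> sqrt (3 / 4)" by (rule real_le_rsqrt) (simp add: power2_eq_square)
    moreover have "sqrt (2 / b) \<le> 1 / 40" using \<eta>(3) \<eta>\<epsilon> \<epsilon> by linarith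
    ultimately show ?thesis by linarith
  qed
  have sq: "\<bar>x\<bar> \<le> sqrt (3 / 4)" if "x\<^sup>2 \<le> 3 / 4" for x
    using real_le_rsqrt[of "\<bar>x\<bar>" "3 / 4"] that by simp
  have others: "\<bar>Q i j\<bar> \<le> sqrt (3 / 4)" if ij: "i \<le> n" "j < n" for i j
  proof -
    have "(\<Sum>i<a + b. (Q i j)\<^sup>2) = 1"
      using pivoted_factorsD(4)[OF pf, of j j] ij n by (simp add: Q_def power2_eq_square)
    then have norm: "(\<Sum>k<a. (Q k j)\<^sup>2) + (\<Sum>r<b. (Q (a + r) j)\<^sup>2) = 1"
      by (simp add: sum_split)
    have i: "i < a \<or> (\<exists>r<b. i = a + r)"
      using ij n(1) by (cases "i < a") (auto intro: exI[of _ "i - a"])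
    show ?thesis
    proof (cases "j < a")
      case True
      have y: "Q (a + r) j = (\<Sum>k<a. link r k * Q k j)" if "r < b" for r
        using top_columns_link[OF pf True that] by (simp add: Q_def)
      note bounds = top_column_bounds[of "\<lambda>r. Q (a + r) j" "\<lambda>k. Q k j", OF y norm]
      from i show ?thesis
      proof
        assume "i < a"
        then show ?thesis using bounds(1)[of i] by (intro sq) simp
      next
        assume "\<exists>r<b. i = a + r"
        then obtain r where r: "r < b" "i = a + r" by blast
        have "0 \<le> sqrt (2 / b)" by simp
        then show ?thesis using bounds(2)[OF _ r(1)] s unfolding r(2) by linarith
      qed
    next
      case False
      have x: "Q k j = - (\<Sum>r<b. link r k * Q (a + r) j)" if "k < a" for k
        using bottom_columns_link[OF pf _ _ that, of j] False ij n by (simp add: Q_def)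
      note bounds = bottom_column_bounds[of "\<lambda>k. Q k j" "\<lambda>r. Q (a + r) j", OF x norm ba
          weights_spread(1)[OF \<epsilon> band]]
      from i show ?thesis
      proof
        assume i: "i < a"
        show ?thesis
        proof (cases "i = 0")
          case True
          have "(Q 0 j)\<^sup>2 + (Q 0 n)\<^sup>2 \<le> 1"
            unfolding Q_def using ij n by (intro orthonormal_columns_row_bound[OF pf']) auto
          then show ?thesis using corner True by (intro sq) simp
        next
          case False
          then show ?thesis using bounds(1)[OF _ i weights_spread(2)[OF \<epsilon> band _ i]] by (intro sq) simp
        qed
      next
        assume "\<exists>r<b. i = a + r"
        then obtain r where r: "r < b" "i = a + r" by blast
        then show ?thesis using bounds(2)[OF _ r(1)] s unfolding r(2) by linarith
      qed
    qed
  qed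
  \<comment> \<open>The entries of the last column are at most \<open>2\<^bsup>n - 1\<^esup> / \<bar>u\<bar>\<close>, with the lower bound for \<open>\<bar>u\<bar>\<close> inserted.\<close>
  define M where "M = sqrt 3 / (2 * (1 - 4 * \<epsilon>))"
  have \<delta>: "0 < 1 - 4 * \<epsilon>" "1 - 4 * \<epsilon> \<le> 1" using \<epsilon> \<epsilon>0 by auto
  have M0: "0 < M" using \<delta> by (simp add: M_def)
  have entries: "\<bar>Q i j\<bar> \<le> M" if "i < Suc n" "j < Suc n" for i j
  proof (cases "j = n")
    case False
    then have "\<bar>Q i j\<bar> \<le> sqrt (3 / 4)" using others that by auto
    also have "\<dots> = sqrt 3 / 2" by (simp add: real_sqrt_divide)
    also have "\<dots> \<le> M" unfolding M_def using \<delta> by (intro divide_left_mono) auto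
    finally show ?thesis .
  next
    case True
    have "\<bar>u\<bar> * \<bar>Q i n\<bar> \<le> 2 ^ (n - 1)" using last[of i] that by (simp add: abs_mult)
    moreover have "(1 - 4 * \<epsilon>) * 2 ^ n / sqrt 3 * \<bar>Q i n\<bar> \<le> \<bar>u\<bar> * \<bar>Q i n\<bar>"
      using u by (intro mult_right_mono) auto
    moreover have "(2::real) ^ n = 2 * 2 ^ (n - 1)" using n by (cases n) auto
    then have "2 ^ (n - 1) * (2 * (1 - 4 * \<epsilon>) / sqrt 3 * \<bar>Q i n\<bar>)
        = (1 - 4 * \<epsilon>) * 2 ^ n / sqrt 3 * \<bar>Q i n\<bar>"
      by simp
    ultimately have "2 ^ (n - 1) * (2 * (1 - 4 * \<epsilon>) / sqrt 3 * \<bar>Q i n\<bar>) \<le> 2 ^ (n - 1) * 1"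
      by linarith
    then have "2 * (1 - 4 * \<epsilon>) / sqrt 3 * \<bar>Q i n\<bar> \<le> 1"
      by (subst (asm) mult_le_cancel_left_pos) auto
    then show ?thesis using True \<delta> by (simp add: M_def field_simps)
  qed
  have Mle: "entry_max (Suc n) Q \<le> M" using entries by (intro entry_max_le) auto
  have Mpos: "0 < entry_max (Suc n) Q" unfolding Q_def using entry_max_pos[OF pf'] by simp
  have "(1 - 4 * \<epsilon>)\<^sup>2 * (2 / 3 * 2 ^ n) = ((1 - 4 * \<epsilon>) * 2 ^ n / sqrt 3) / M"
    using \<delta> by (simp add: M_def power2_eq_square field_simps)
  also have "\<dots> \<le> \<bar>u\<bar> / entry_max (Suc n) Q"
    using u Mle Mpos u0 by (intro frac_le) auto
  also have "\<dots> \<le> lu_growth (Suc n) left_factor U"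
    using lu_growth_ge_entry[OF pf', of n n n] left_factor_bounds(1)[of n]
    by (simp add: u_def Q_def stage_diag)
  finally show ?thesis using pf n(1) by auto
qed

end

section \<open>Asymptotics\<close>

lemma max_lu_growth_upper:
  assumes "2 \<le> n"
  shows "max_lu_growth n \<le> 2 / 3 * (2 ^ (n - 1) + 1)"
proof -
  obtain m where m: "n = Suc m" "0 < m" using assms by (cases n) auto
  show ?thesis using lu_growth_upper[of m] m by (intro max_lu_growth_le) simp
qed

text \<open>
  The blocks are taken of nearly equal size, and a band width of about \<open>2 log n\<close> is wide enough for the
  weights to be nearly powers of two and narrow enough for \<open>\<eta>\<close> to tend to 0.
\<close>

lemma max_lu_growth_lower:
  assumes \<epsilon>: "0 < \<epsilon>" "\<epsilon> \<le> 1 / 40"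
  shows "\<forall>\<^sub>F n in sequentially. (1 - 4 * \<epsilon>)\<^sup>2 * (2 / 3 * 2 ^ (n - 1)) \<le> max_lu_growth n"
proof -
  define K where "K n = nat \<lceil>2 * log 2 (real n)\<rceil>" for n
  have "((\<lambda>n. (2 * log 2 (real n) + 2) * sqrt (4 / (real n - 1))) \<longlongrightarrow> 0) sequentially"
    by real_asymp
  then have e1: "\<forall>\<^sub>F n in sequentially. (2 * log 2 (real n) + 2) * sqrt (4 / (real n - 1)) < \<epsilon>"
    using \<epsilon>(1) by (rule order_tendstoD)
  have "((\<lambda>n. 1 / real n) \<longlongrightarrow> 0) sequentially" by real_asymp
  then have e2: "\<forall>\<^sub>F n in sequentially. 1 / real n < \<epsilon>"
    using \<epsilon>(1) by (rule order_tendstoD)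
  have "((\<lambda>n. 1 / 4 powr ((real n - 2) / 2)) \<longlongrightarrow> 0) sequentially" by real_asymp
  then have e3: "\<forall>\<^sub>F n in sequentially. 1 / 4 powr ((real n - 2) / 2) < \<epsilon>"
    using \<epsilon>(1) by (rule order_tendstoD)
  show ?thesis
    using e1 e2 e3 eventually_ge_at_top[of 6]
  proof eventually_elim
    case (elim n)
    define a where "a = (n - 1) div 2"
    define b where "b = n - a"
    have ab: "2 \<le> a" "Suc a \<le> b" "b \<le> Suc (Suc a)" "a + b = n" "n \<le> 2 * a + 2" "n \<le> 2 * b"
      "a \<le> n"
      using elim(4) unfolding a_def b_def by auto
    have l0: "0 < log 2 (real n)" using elim(4) by simp
    then have K: "0 < K n" "2 * log 2 (real n) \<le> real (K n)" "real (K n) \<le> 2 * log 2 (real n) + 1"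
      unfolding K_def by (auto simp: of_nat_nat intro!: less_imp_le)
    have "real (Suc (K n)) * sqrt (2 / b) \<le> (2 * log 2 (real n) + 2) * sqrt (4 / (real n - 1))"
    proof (intro mult_mono)
      have "real n - 1 \<le> 2 * real b" using ab(6) by linarith
      then have "2 / real b \<le> 4 / (real n - 1)"
        using elim(4) ab by (simp add: field_simps)
      then show "sqrt (2 / b) \<le> sqrt (4 / (real n - 1))" by simp
    qed (use K l0 in auto)
    then have \<eta>: "real (Suc (K n)) * sqrt (2 / b) \<le> \<epsilon>" using elim(1) by linarith
    have tb: "two_block a b (K n)"
      by (rule two_block.intro[OF ab(1,2) K(1)]) (use \<eta> \<epsilon>(2) in linarith)
    have L: "2 powr log 2 (real n) = real n" using elim(4) by (intro powr_log_cancel) auto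
    have "real n * real n = 2 powr (log 2 (real n) + log 2 (real n))" unfolding powr_add L ..
    also have "\<dots> \<le> 2 powr real (K n)" using K(2) by (intro powr_mono) linarith+
    also have "\<dots> = 2 ^ K n" by (simp add: powr_realpow)
    also have "\<dots> \<le> 2 ^ Suc (K n)" by simp
    finally have "real a * real n \<le> 2 ^ Suc (K n)"
      using mult_right_mono[of "real a" "real n" "real n"] ab(7) by linarith
    then have "real a / 2 ^ Suc (K n) \<le> 1 / real n"
      using elim(4) by (simp add: field_simps del: power_Suc)
    then have band: "real a / 2 ^ Suc (K n) \<le> \<epsilon>" using elim(2) by linarith
    have "4 powr ((real n - 2) / 2) \<le> 4 powr real a" using ab(5) by (intro powr_mono) auto
    then have "1 / 4 ^ a \<le> 1 / 4 powr ((real n - 2) / 2)"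
      by (simp add: powr_realpow frac_le)
    then have tail: "1 / 4 ^ a \<le> \<epsilon>" using elim(3) by linarith
    obtain L U where "pivoted_factors n L U"
      "(1 - 4 * \<epsilon>)\<^sup>2 * (2 / 3 * 2 ^ (n - 1)) \<le> lu_growth n L U"
      using two_block.near_extremal_growth[OF tb ab(3) _ \<epsilon>(2) band tail] \<eta>
      unfolding two_block.\<eta>_def[OF tb] ab(4) by blast
    then show ?case using max_lu_growth_ge[of n L U] elim(4) by linarith
  qed
qed

lemma max_lu_growth_asymptotics:
  "(\<lambda>n. max_lu_growth n / (2 / 3 * 2 ^ (n - 1)) - 1) \<longlonglongrightarrow> 0"
proof (rule order_tendstoI)
  fix y :: real assume y: "y < 0"
  define \<epsilon> where "\<epsilon> = min (1 / 40) (- y / 16)"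
  have \<epsilon>: "0 < \<epsilon>" "\<epsilon> \<le> 1 / 40" "16 * \<epsilon> \<le> - y" using y by (auto simp: \<epsilon>_def)
  show "\<forall>\<^sub>F n in sequentially. y < max_lu_growth n / (2 / 3 * 2 ^ (n - 1)) - 1"
    using max_lu_growth_lower[OF \<epsilon>(1,2)]
  proof eventually_elim
    case (elim n)
    then have "(1 - 4 * \<epsilon>)\<^sup>2 \<le> max_lu_growth n / (2 / 3 * 2 ^ (n - 1))"
      by (subst pos_le_divide_eq) auto
    moreover have "(1 - 4 * \<epsilon>)\<^sup>2 = 1 - 8 * \<epsilon> + 16 * \<epsilon>\<^sup>2"
      by (simp add: power2_eq_square algebra_simps)
    ultimately show ?case using \<epsilon> zero_le_power2[of \<epsilon>] by linarith
  qed
next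
  fix y :: real assume y: "0 < y"
  have "((\<lambda>n. 1 / 2 ^ (n - 1) :: real) \<longlongrightarrow> 0) sequentially" by real_asymp
  then have "\<forall>\<^sub>F n in sequentially. 1 / 2 ^ (n - 1) < y" using y by (rule order_tendstoD)
  then show "\<forall>\<^sub>F n in sequentially. max_lu_growth n / (2 / 3 * 2 ^ (n - 1)) - 1 < y"
    using eventually_ge_at_top[of 2]
  proof eventually_elim
    case (elim n)
    have "(1 + 1 / 2 ^ (n - 1)) * (2 / 3 * 2 ^ (n - 1)) = (2 / 3 * (2 ^ (n - 1) + 1) :: real)"
      by (simp add: field_simps)
    then have "max_lu_growth n / (2 / 3 * 2 ^ (n - 1)) \<le> 1 + 1 / 2 ^ (n - 1)"
      using max_lu_growth_upper[OF elim(2)] by (subst pos_divide_le_eq, simp, linarith)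
    then show ?case using elim(1) by linarith
  qed
qed

theorem theorem3p9:
  shows "(\<forall>p. pivot_rule p \<longrightarrow>
           (\<forall>n\<ge>1. \<exists>A \<in> orthogonal_group n.
              gepp_growth p A = max_gepp_growth p (orthogonal_group n) \<and>
              (\<forall>B \<in> orthogonal_group n. gepp_growth p B \<le> gepp_growth p A)) \<and>
           (\<forall>n \<in> {1, 2}. max_gepp_growth p (orthogonal_group n) = real n)) \<and>
         (\<exists>c :: real. 1 / sqrt 3 \<le> c \<and> c < 1 \<and>
           (\<exists>e :: nat \<Rightarrow> real. e \<longlonglongrightarrow> 0 \<and>
             (\<forall>p. pivot_rule p \<longrightarrow> (\<forall>n\<ge>3.
                max_gepp_growth p (orthogonal_group n) = c * 2 ^ (n - 1) * (1 + e n)))))"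
proof (intro conjI)
  show "\<forall>p. pivot_rule p \<longrightarrow>
           (\<forall>n\<ge>1. \<exists>A \<in> orthogonal_group n.
              gepp_growth p A = max_gepp_growth p (orthogonal_group n) \<and>
              (\<forall>B \<in> orthogonal_group n. gepp_growth p B \<le> gepp_growth p A)) \<and>
           (\<forall>n \<in> {1, 2}. max_gepp_growth p (orthogonal_group n) = real n)"
  proof (intro allI impI conjI ballI)
    fix p n assume p: "pivot_rule p" and "1 \<le> (n::nat)"
    then show "\<exists>A \<in> orthogonal_group n.
        gepp_growth p A = max_gepp_growth p (orthogonal_group n) \<and>
        (\<forall>B \<in> orthogonal_group n. gepp_growth p B \<le> gepp_growth p A)"
      by (intro gepp_growth_attains_max) auto
  next
    fix p and n :: nat assume p: "pivot_rule p" and "n \<in> {1, 2}"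
    then consider "n = 1" | "n = 2" by blast
    then show "max_gepp_growth p (orthogonal_group n) = real n"
      using max_gepp_growth_eq[OF p, of n] max_lu_growth_1 max_lu_growth_2 by cases auto
  qed
next
  define e where "e n = max_lu_growth n / (2 / 3 * 2 ^ (n - 1)) - 1" for n
  have "max_gepp_growth p (orthogonal_group n) = 2 / 3 * 2 ^ (n - 1) * (1 + e n)"
    if "pivot_rule p" "3 \<le> n" for p n
    using max_gepp_growth_eq[OF that(1), of n] that(2) by (simp add: e_def)
  moreover have "e \<longlonglongrightarrow> 0" unfolding e_def[abs_def] by (rule max_lu_growth_asymptotics)
  moreover have "1 / sqrt 3 \<le> (2 / 3 :: real)"
  proof -
    have "3 / 2 \<le> sqrt 3" by (rule real_le_rsqrt) (simp add: power2_eq_square)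
    then show ?thesis by (simp add: field_simps)
  qed
  ultimately show "\<exists>c :: real. 1 / sqrt 3 \<le> c \<and> c < 1 \<and>
      (\<exists>e :: nat \<Rightarrow> real. e \<longlonglongrightarrow> 0 \<and>
        (\<forall>p. pivot_rule p \<longrightarrow> (\<forall>n\<ge>3.
           max_gepp_growth p (orthogonal_group n) = c * 2 ^ (n - 1) * (1 + e n))))"
    by (intro exI[of _ "2 / 3"] conjI exI[of _ e]) auto
qed

end
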